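(* Let $s>s_1>\frac12$, let $u\in L^2_s(\mathbb{R})$ be real-valued, and for $\lambda>0$ let $m_1(\cdot,\lambda\pm0i)$ and $m_e(\cdot,\lambda\pm0i)$ be the Jost solutions, i.e. the unique functions in $L^\infty_{-(s-s_1)}(\mathbb{R})$ with $m_1(\lambda\pm0i)=1+G_{\lambda\pm0i}*(u\,m_1(\lambda\pm0i))$ and $m_e(\lambda\pm0i)=\mathbf{e}(\lambda)+G_{\lambda\pm0i}*(u\,m_e(\lambda\pm0i))$. For $\lambda>0$ define $$\Gamma(\lambda)=1+i\int_{\mathbb{R}}u(x)m_e(x,\lambda+0i)e^{-i\lambda x}\,dx,$$ $$\beta(\lambda)=i\int_{\mathbb{R}}u(x)m_1(x,\lambda+0i)e^{-i\lambda x}\,dx,\qquad f(\lambda)=-\frac1{2\pi\lambda}\int_{\mathbb{R}}u(x)m_e(x,\lambda-0i)\,dx.$$ Then $$\Gamma(\lambda)=\frac1{1-i\int_{\mathbb{R}}u(x)m_e(x,\lambda-0i)e^{-i\lambda x}\,dx},$$ and the following relations hold for all $\lambda>0$: $$m_e(\lambda+0i)=\Gamma(\lambda)\,m_e(\lambda-0i),$$ $$m_1(\lambda+0i)-m_1(\lambda-0i)=\beta(\lambda)\,m_e(\lambda-0i),$$ $$\mathbf{e}(\lambda)\,\partial_\lambda\big(\overline{\mathbf{e}}(\lambda)\,m_e(\lambda-0i)\big)=f(\lambda)\,m_1(\lambda-0i).$$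
   Context: Notation. $w(x)=1+|x|$; $L^p_s(\mathbb{R})=\{f: w^sf\in L^p(\mathbb{R})\}$ with norm $\|w^sf\|_p$. $\mathbb{R}^+=(0,\infty)$, $\mathbb{R}^-=(-\infty,0)$. $\mathbf{e}(\lambda)=\mathbf{e}(x,\lambda)=e^{i\lambda x}$ and $\overline{\mathbf{e}}(\lambda)=e^{-i\lambda x}$. Kernels: for $\lambda>0$, $\widetilde G_\lambda(x)=\frac1{2\pi}\int_{-\infty}^0\frac{e^{ix\xi}}{\xi-\lambda}\,d\xi$ and $G_{\lambda\pm0i}(x)=\pm ie^{i\lambda x}\chi_{\mathbb{R}^\pm}(x)-\widetilde G_\lambda(x)$. It is known (and may be taken as part of the setting) that for real-valued $u\in L^2_s(\mathbb{R})$ with $s>s_1>\frac12$ and each $\lambda>0$ the integral equations $m_1(\lambda\pm0i)=1+G_{\lambda\pm0i}*(u\,m_1(\lambda\pm0i))$ and $m_e(\lambda\pm0i)=\mathbf{e}(\lambda)+G_{\lambda\pm0i}*(u\,m_e(\lambda\pm0i))$ have unique solutions in $L^\infty_{-(s-s_1)}(\mathbb{R})$, and that these lie in $L^\infty(\mathbb{R})$. The derivative $\partial_\lambda$ is that of the map $\lambda\mapsto\overline{\mathbf{e}}(\lambda)m_e(\lambda-0i)$ from $(0,\infty)$ into $L^\infty_{-(s-s_1)}(\mathbb{R})$. *)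

theory Defs
  imports "HOL-Analysis.Analysis" "HOL-Probability.Essential_Supremum"
begin

text \<open>Elements of the function spaces are represented by functions on the real line that are
  measurable with respect to \<^const>\<open>lebesgue\<close>; equality in these spaces is equality almost
  everywhere.\<close>

definition weight :: "real \<Rightarrow> real" where
  "weight x = 1 + \<bar>x\<bar>"

definition L2_weighted :: "real \<Rightarrow> (real \<Rightarrow> real) set" where
  "L2_weighted s = {u. u \<in> borel_measurable lebesgue \<and>
     integrable lebesgue (\<lambda>x. (weight x powr s * u x)\<^sup>2)}"

definition Linf_norm :: "real \<Rightarrow> (real \<Rightarrow> complex) \<Rightarrow> ennreal" where
  "Linf_norm r f = esssup lebesgue (\<lambda>x. ennreal (weight x powr r * norm (f x)))"

definition Linf_weighted :: "real \<Rightarrow> (real \<Rightarrow> complex) set" where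
  "Linf_weighted r = {f. f \<in> borel_measurable lebesgue \<and> Linf_norm r f < \<infinity>}"

text \<open>Derivative at \<open>t\<close>, with value \<open>D\<close>, of a map \<open>F\<close> into the weighted \<open>L\<^sup>\<infinity>\<close> space of
  exponent \<open>r\<close>: the difference quotients converge to \<open>D\<close> in the norm of that space.\<close>

definition has_Linf_derivative ::
  "real \<Rightarrow> (real \<Rightarrow> real \<Rightarrow> complex) \<Rightarrow> (real \<Rightarrow> complex) \<Rightarrow> real \<Rightarrow> bool" where
  "has_Linf_derivative r F D t \<longleftrightarrow>
     D \<in> Linf_weighted r \<and> (\<forall>\<^sub>F \<tau> in nhds t. F \<tau> \<in> Linf_weighted r) \<and>
     ((\<lambda>h. Linf_norm r (\<lambda>x. (F (t + h) x - F t x) / complex_of_real h - D x)) \<longlongrightarrow> 0) (at 0)"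

definition plane_wave :: "real \<Rightarrow> real \<Rightarrow> complex" where
  "plane_wave lam x = exp (\<i> * complex_of_real (lam * x))"

text \<open>The integral defining \<open>G_tilde\<close> converges only conditionally. The Henstock--Kurzweil
  integral over the unbounded set \<open>{..0}\<close> is the limit of the integrals over bounded intervals, so
  it is the improper integral for every \<open>x \<noteq> 0\<close>. At \<open>x = 0\<close> the integral diverges
  and the value (0) is irrelevant.\<close>

definition G_tilde :: "real \<Rightarrow> real \<Rightarrow> complex" where
  "G_tilde lam x = 1 / (2 * complex_of_real pi) *
     integral {..0} (\<lambda>\<xi>::real. exp (\<i> * complex_of_real (x * \<xi>)) / complex_of_real (\<xi> - lam))"

definition G_plus :: "real \<Rightarrow> real \<Rightarrow> complex" where
  "G_plus lam x = \<i> * plane_wave lam x * indicator {0<..} x - G_tilde lam x"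

definition G_minus :: "real \<Rightarrow> real \<Rightarrow> complex" where
  "G_minus lam x = - \<i> * plane_wave lam x * indicator {..<0} x - G_tilde lam x"

definition convolution :: "(real \<Rightarrow> complex) \<Rightarrow> (real \<Rightarrow> complex) \<Rightarrow> real \<Rightarrow> complex" where
  "convolution G h x = (LINT y|lebesgue. G (x - y) * h y)"

definition solves ::
  "real \<Rightarrow> (real \<Rightarrow> real) \<Rightarrow> (real \<Rightarrow> complex) \<Rightarrow> (real \<Rightarrow> complex) \<Rightarrow> (real \<Rightarrow> complex) \<Rightarrow> bool" where
  "solves r u G g m \<longleftrightarrow> m \<in> Linf_weighted r \<and>
     (AE x in lebesgue. m x = g x + convolution G (\<lambda>y. complex_of_real (u y) * m y) x)"

definition unique_solution ::
  "real \<Rightarrow> (real \<Rightarrow> real) \<Rightarrow> (real \<Rightarrow> complex) \<Rightarrow> (real \<Rightarrow> complex) \<Rightarrow> (real \<Rightarrow> complex) \<Rightarrow> bool" where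
  "unique_solution r u G g m \<longleftrightarrow> solves r u G g m \<and>
     (\<forall>n. solves r u G g n \<longrightarrow> (AE x in lebesgue. n x = m x))"

text \<open>In the next three definitions \<open>me_plus\<close>, \<open>m1_plus\<close> and \<open>me_minus\<close> stand for the families
  \<open>m\<^sub>e(\<lambda>+0i)\<close>, \<open>m\<^sub>1(\<lambda>+0i)\<close> and \<open>m\<^sub>e(\<lambda>-0i)\<close>; the first argument is \<open>\<lambda>\<close> and the second is \<open>x\<close>.\<close>

definition jost_Gamma :: "(real \<Rightarrow> real) \<Rightarrow> (real \<Rightarrow> real \<Rightarrow> complex) \<Rightarrow> real \<Rightarrow> complex" where
  "jost_Gamma u me_plus lam =
     1 + \<i> * (LINT x|lebesgue. complex_of_real (u x) * me_plus lam x * cnj (plane_wave lam x))"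

definition jost_beta :: "(real \<Rightarrow> real) \<Rightarrow> (real \<Rightarrow> real \<Rightarrow> complex) \<Rightarrow> real \<Rightarrow> complex" where
  "jost_beta u m1_plus lam =
     \<i> * (LINT x|lebesgue. complex_of_real (u x) * m1_plus lam x * cnj (plane_wave lam x))"

definition jost_f :: "(real \<Rightarrow> real) \<Rightarrow> (real \<Rightarrow> real \<Rightarrow> complex) \<Rightarrow> real \<Rightarrow> complex" where
  "jost_f u me_minus lam =
     - 1 / (2 * complex_of_real pi * complex_of_real lam) *
       (LINT x|lebesgue. complex_of_real (u x) * me_minus lam x)"

end

theory Submission
  imports Defs
begin

text \<open>The kernels \<open>G\<^sub>+\<close> and \<open>G\<^sub>-\<close> differ by \<open>i\<close> times the plane wave, so each equation for \<open>\<lambda> + 0i\<close> is an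
  equation for \<open>\<lambda> - 0i\<close> with another inhomogeneity, and uniqueness gives the first two relations.

  For the derivative, multiply the equation by the conjugate plane wave. The resulting kernel
  \<open>K\<^sub>\<lambda>\<close> satisfies \<open>\<partial>\<^sub>\<lambda> K\<^sub>\<lambda>(x) = - exp (- i \<lambda> x) / (2 \<pi> \<lambda>)\<close>, which makes the differentiated equation the one
  for \<open>f m\<^sub>1\<close>. In the weighted supremum norm the convolution operator is compact, so uniqueness
  makes \<open>1 - T\<^sub>\<lambda>\<close> bounded below. This turns the convergence of the difference quotients of \<open>K\<^sub>\<lambda>\<close>, at
  the rate \<open>|h|\<^sup>\<theta> (1 + |x|)\<^sup>\<theta>\<close> with \<open>\<theta> \<le> s - s1\<close>, into convergence for the solutions.\<close>

section \<open>The kernels\<close>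

text \<open>The obstacle is that the second \<lambda>-derivative of the reduced kernel grows like
  |x|, so its difference quotients do not converge uniformly in x, although the kernel is Lipschitz
  in \<lambda> uniformly in x. Interpolation between a bounded and a linear estimate leaves a growth
  (1 + |x|)^\<theta>, which is shared out by 1 + |x - y| \<le> (1 + |x|) (1 + |y|). The factor in x
  is paid by the weight of the norm, the factor in y by the potential, because the solution at the
  fixed \<lambda> is bounded and w^(s - s1) is to spare. The estimates are made for p = w^(-(s -
  s1)) times the conjugate wave times m, a bounded continuous function, with the opposite weight
  moved onto the potential: v = w^(s - s1) u. By s1 > 1/2 this \<open>v\<close> lies in L^1 and in
  L^2. The L^1 norm meets the bounded part of the kernel and the L^2 norm its singularity at 0; that
  singularity is logarithmic, and |x|^(-1/4) is a convenient bound with locally integrable square.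
  The lower bound for 1 - T is used at one \<lambda> only; at \<lambda> + h the solution is
  controlled by absorbing a small multiple of its increment.\<close>

lemma has_integral_antiderivative_at_bot:
  fixes F f :: "real \<Rightarrow> 'a::banach"
  assumes deriv: "\<And>x. x \<le> c \<Longrightarrow> (F has_vector_derivative f x) (at x within {..c})"
    and lim: "(F \<longlongrightarrow> 0) at_bot"
  shows "(f has_integral F c) {..c}"
proof -
  \<comment> \<open>Over a set that is not a box the integral is a limit over boxes containing large
    balls, so that clause has to be selected first. It covers conditionally convergent
    integrals.\<close>
  have nbox: "\<not> (\<exists>a b. {..c} = cbox a (b::real))"
  proof (rule notI, elim exE)
    fix a b assume eq: "{..c} = cbox a b"
    have "min a c - 1 \<in> cbox a b" unfolding eq[symmetric] by simp
    hence "a \<le> min a c - 1" by simp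
    thus False by linarith
  qed
  show ?thesis
  proof (subst has_integral_alt[of f "F c" "{..c}"], subst if_not_P[OF nbox], intro allI impI)
    fix e :: real assume "e > 0"
    then obtain N where N: "\<And>x. x \<le> N \<Longrightarrow> norm (F x) < e"
      using tendstoD[OF lim] by (auto simp: eventually_at_bot_linorder)
    \<comment> \<open>Makes every admissible box reach left of \<open>N\<close> and right of
      \<open>c\<close>, so that the integral over it is \<open>F c - F a\<close> with
      \<open>F a\<close> small.\<close>
    define B where "B = \<bar>N\<bar> + \<bar>c\<bar> + 1"
    show "\<exists>B>0. \<forall>a b. ball 0 B \<subseteq> cbox a b \<longrightarrow>
      (\<exists>z. ((\<lambda>x. if x \<in> {..c} then f x else 0) has_integral z) (cbox a b) \<and> norm (z - F c) < e)"
    proof (intro exI[of _ B] conjI allI impI)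
      show "B > 0" by (simp add: B_def)
      fix a b :: real assume "ball 0 B \<subseteq> cbox a b"
      hence "{-B<..<B} \<subseteq> {a..b}" by (simp add: ball_eq_greaterThanLessThan)
      hence ab: "a \<le> -B" "B \<le> b"
        using \<open>B > 0\<close> by (simp_all add: greaterThanLessThan_subseteq_atLeastAtMost_iff)
      have "(f has_integral (F c - F a)) {a..c}"
        using ab by (intro fundamental_theorem_of_calculus)
          (auto simp: B_def intro: has_vector_derivative_within_subset[OF deriv])
      moreover have "{..c} \<inter> cbox a b = {a..c}" using ab by (auto simp: B_def)
      ultimately have "((\<lambda>x. if x \<in> {..c} then f x else 0) has_integral (F c - F a)) (cbox a b)"
        by (subst has_integral_restrict_Int) (simp del: box_real)
      moreover have "norm (F c - F a - F c) < e"
        using N[of a] ab by (simp add: B_def)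
      ultimately show "\<exists>z. ((\<lambda>x. if x \<in> {..c} then f x else 0) has_integral z) (cbox a b) \<and>
          norm (z - F c) < e"
        by blast
    qed
  qed
qed

text \<open>Serves three times: p = 1 for the inverse square, p = 1/4 for the bound on
  \<open>G_tilde\<close>, and lam = 1 for powers of the weight.\<close>

lemma has_integral_shifted_powr:
  assumes "lam > (0::real)" "p > 0"
  shows "((\<lambda>\<xi>. (lam - \<xi>) powr (- p - 1)) has_integral (lam powr (- p) / p)) {..0}"
proof -
  define F where "F \<xi> = (lam - \<xi>) powr (- p) / p" for \<xi>
  have "((\<lambda>\<xi>. (lam - \<xi>) powr (- p - 1)) has_integral F 0) {..0}"
  proof (rule has_integral_antiderivative_at_bot)
    fix x :: real assume "x \<le> 0"
    hence "(F has_real_derivative (lam - x) powr (- p - 1)) (at x)"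
      unfolding F_def using assms by (auto intro!: derivative_eq_intros)
    thus "(F has_vector_derivative (lam - x) powr (- p - 1)) (at x within {..0})"
      by (simp add: has_real_derivative_iff_has_vector_derivative has_vector_derivative_at_within)
  next
    have "filterlim (\<lambda>\<xi>. lam - \<xi>) at_top at_bot"
      using filterlim_tendsto_add_at_top[OF tendsto_const[of lam] filterlim_uminus_at_top_at_bot] by simp
    from tendsto_neg_powr[OF _ this, of "-p"] assms show "(F \<longlongrightarrow> 0) at_bot"
      unfolding F_def by (auto intro: tendsto_divide_zero)
  qed
  thus ?thesis by (simp add: F_def)
qed

lemma shifted_square_conv_powr:
  "lam > 0 \<Longrightarrow> \<xi> \<le> 0 \<Longrightarrow> 1 / (\<xi> - lam)\<^sup>2 = (lam - \<xi>) powr (- 1 - 1)" for lam \<xi> :: real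
  by (simp add: powr_minus_divide powr_numeral power2_commute)

lemma has_integral_inverse_square:
  assumes "lam > (0::real)"
  shows "((\<lambda>\<xi>. 1 / (\<xi> - lam)\<^sup>2) has_integral (1 / lam)) {..0}"
proof -
  have "((\<lambda>\<xi>. (lam - \<xi>) powr (- 1 - 1)) has_integral (1 / lam)) {..0}"
    using has_integral_shifted_powr[OF assms, of 1] assms by (simp add: powr_minus_divide)
  thus ?thesis
    by (rule has_integral_eq[rotated]) (metis atMost_iff assms shifted_square_conv_powr)
qed

lemma tendsto_inverse_at_bot: "((\<lambda>\<xi>::real. C / \<bar>\<xi> - lam\<bar>) \<longlongrightarrow> 0) at_bot" for C :: real
proof -
  have "filterlim (\<lambda>\<xi>. \<xi> - lam) at_bot at_bot"
    using filterlim_tendsto_add_at_bot_iff[OF tendsto_const[of "-lam"], of "\<lambda>\<xi>. \<xi>"]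
    by (simp add: filterlim_ident)
  hence "filterlim (\<lambda>\<xi>. \<bar>\<xi> - lam\<bar>) at_top at_bot"
    using filterlim_compose[OF filterlim_norm_at_top filterlim_at_bot_imp_at_infinity] by simp
  thus ?thesis by (intro real_tendsto_divide_at_top[OF tendsto_const])
qed

text \<open>Integrating by parts with the primitive \<open>exp (i x \<xi>) - 1\<close> removes the boundary term at 0.\<close>

definition G_tilde_integrand :: "real \<Rightarrow> real \<Rightarrow> real \<Rightarrow> complex" where
  "G_tilde_integrand lam x \<xi> = (exp (\<i> * complex_of_real (x * \<xi>)) - 1) / complex_of_real ((\<xi> - lam)\<^sup>2)"

lemma norm_exp_i_minus_one_le: "norm (exp (\<i> * complex_of_real t) - 1) \<le> \<bar>t\<bar>"
proof -
  have "norm (exp (\<i> * complex_of_real t) - 1) = 2 * \<bar>sin (t / 2)\<bar>"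
    by (rule dist_exp_i_1)
  also have "\<dots> \<le> 2 * \<bar>t / 2\<bar>" by (intro mult_left_mono abs_sin_x_le_abs_x) auto
  finally show ?thesis by simp
qed

lemma norm_exp_i_minus_one_le_2: "norm (exp (\<i> * complex_of_real t) - 1) \<le> 2"
  using norm_triangle_ineq4[of "exp (\<i> * complex_of_real t)" 1] by simp

text \<open>Geometric interpolation: write z = z^(1 - \<theta>) z^\<theta> and bound the factors by
  different estimates. It trades a uniform bound against a linear one, first in the size of x \<xi>,
  later in that of the step h.\<close>

lemma min_le_powr:
  fixes a b z \<theta> :: real
  assumes "0 \<le> a" "0 \<le> b" "z \<le> a" "z \<le> b" "0 < \<theta>" "\<theta> \<le> 1"
  shows "z \<le> a powr (1 - \<theta>) * b powr \<theta>"
proof (cases "z \<le> 0")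
  case True
  thus ?thesis by (meson mult_nonneg_nonneg order_trans powr_ge_zero)
next
  case False
  hence "z = z powr (1 - \<theta>) * z powr \<theta>" by (simp flip: powr_add)
  also have "\<dots> \<le> a powr (1 - \<theta>) * b powr \<theta>"
    using assms False by (intro mult_mono powr_mono2) auto
  finally show ?thesis .
qed

lemma G_tilde_integrand_absolutely_integrable:
  assumes "lam > 0"
  shows "G_tilde_integrand lam x absolutely_integrable_on {..0}"
proof (rule measurable_bounded_by_integrable_imp_absolutely_integrable)
  show "(\<lambda>\<xi>. 2 * (1 / (\<xi> - lam)\<^sup>2)) integrable_on {..0}"
    using has_integral_mult_right[OF has_integral_inverse_square[OF assms], of 2]
    by (auto simp: integrable_on_def)
  show "G_tilde_integrand lam x \<in> borel_measurable (lebesgue_on {..0})"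
    unfolding G_tilde_integrand_def
    by (intro measurable_restrict_space1 measurable_completion) measurable
  fix \<xi> :: real
  show "norm (G_tilde_integrand lam x \<xi>) \<le> 2 * (1 / (\<xi> - lam)\<^sup>2)"
    unfolding G_tilde_integrand_def norm_divide norm_of_real
    using norm_exp_i_minus_one_le_2[of "x * \<xi>"] by (simp add: divide_right_mono)
qed auto

lemma has_integral_G_tilde:
  assumes "lam > 0" "x \<noteq> 0"
  shows "((\<lambda>\<xi>. exp (\<i> * complex_of_real (x * \<xi>)) / complex_of_real (\<xi> - lam)) has_integral
           integral {..0} (G_tilde_integrand lam x) / (\<i> * complex_of_real x)) {..0}"
proof -
  define F where "F \<xi> = (exp (\<i> * complex_of_real (x * \<xi>)) - 1) /
    (\<i> * complex_of_real x * complex_of_real (\<xi> - lam))" for \<xi>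
  \<comment> \<open>The difference of the two integrands has the antiderivative \<open>F\<close>,
    which tends to 0 at -\<infinity> and vanishes at 0 because of the \<open>- 1\<close> in its
    numerator. Hence \<open>f\<close> integrates to 0.\<close>
  define f where "f \<xi> = exp (\<i> * complex_of_real (x * \<xi>)) / complex_of_real (\<xi> - lam)
     - G_tilde_integrand lam x \<xi> / (\<i> * complex_of_real x)" for \<xi>
  have "(f has_integral F 0) {..0}"
  proof (rule has_integral_antiderivative_at_bot)
    fix \<xi> :: real assume \<xi>: "\<xi> \<le> 0"
    hence ne: "complex_of_real \<xi> - complex_of_real lam \<noteq> 0"
      using assms(1) by (metis diff_gt_0_iff_gt eq_iff_diff_eq_0 not_less of_real_eq_iff)
    \<comment> \<open>The left side is the form in which the quotient rule delivers the
      derivative.\<close>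
    have quot: "(X * E * (X * d) - (E - 1) * X) / (X * d * (X * d)) = E / d - (E - 1) / d^2 / X"
      if "X \<noteq> 0" "d \<noteq> 0" for X E d :: complex
      using that by (simp add: field_simps power2_eq_square)
    have "((\<lambda>z. (exp (\<i> * (of_real x * z)) - 1) / (\<i> * of_real x * (z - of_real lam))) has_field_derivative
       exp (\<i> * (of_real x * of_real \<xi>)) / (of_real \<xi> - of_real lam)
        - (exp (\<i> * (of_real x * of_real \<xi>)) - 1) / (of_real \<xi> - of_real lam)^2 / (\<i> * of_real x)) (at (complex_of_real \<xi>))"
      using assms(2) ne
      by (subst quot[symmetric]) (auto intro!: derivative_eq_intros simp: mult_ac)
    from has_vector_derivative_real_field[OF this]
    show "(F has_vector_derivative f \<xi>) (at \<xi> within {..0})"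
      by (simp add: F_def [abs_def] f_def G_tilde_integrand_def)
  next
    show "(F \<longlongrightarrow> 0) at_bot"
    proof (rule Lim_null_comparison)
      show "\<forall>\<^sub>F \<xi> in at_bot. norm (F \<xi>) \<le> (2 / \<bar>x\<bar>) / \<bar>\<xi> - lam\<bar>"
      proof (rule always_eventually, rule allI)
        fix \<xi> 
        have "norm (F \<xi>) = norm (exp (\<i> * complex_of_real (x * \<xi>)) - 1) / (\<bar>x\<bar> * \<bar>\<xi> - lam\<bar>)"
          unfolding F_def norm_divide norm_mult norm_of_real by simp
        also have "\<dots> \<le> 2 / (\<bar>x\<bar> * \<bar>\<xi> - lam\<bar>)"
          by (intro divide_right_mono norm_exp_i_minus_one_le_2) auto
        finally show "norm (F \<xi>) \<le> (2 / \<bar>x\<bar>) / \<bar>\<xi> - lam\<bar>" by simp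
      qed
    qed (rule tendsto_inverse_at_bot)
  qed
  hence "(f has_integral 0) {..0}" by (simp add: F_def)
  moreover have "G_tilde_integrand lam x integrable_on {..0}"
    using G_tilde_integrand_absolutely_integrable[OF assms(1)] by (simp add: absolutely_integrable_on_def)
  hence "((\<lambda>\<xi>. G_tilde_integrand lam x \<xi> / (\<i> * complex_of_real x)) has_integral
      integral {..0} (G_tilde_integrand lam x) / (\<i> * complex_of_real x)) {..0}"
    by (intro has_integral_divide integrable_integral)
  ultimately show ?thesis
    using has_integral_add[of f 0 "{..0}" "\<lambda>\<xi>. G_tilde_integrand lam x \<xi> / (\<i> * complex_of_real x)"]
    unfolding f_def by simp
qed

lemma G_tilde_eq:
  assumes "lam > 0" "x \<noteq> 0"
  shows "G_tilde lam x = integral {..0} (G_tilde_integrand lam x) / (2 * complex_of_real pi * \<i> * complex_of_real x)"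
  unfolding G_tilde_def integral_unique[OF has_integral_G_tilde[OF assms]] by simp

text \<open>Interpolating |e^(i x \<xi>) - 1| with exponent 3/4 leaves (lam - \<xi>)^(-5/4), still
  integrable; the prefactor 1 / x then turns |x|^(3/4) into |x|^(-1/4). The exponent matters only in
  that its double exceeds -1, which makes the square integrable near 0.\<close>

lemma norm_G_tilde_le:
  assumes "lam > 0"
  shows "\<exists>C\<ge>0. \<forall>x. x \<noteq> 0 \<longrightarrow> norm (G_tilde lam x) \<le> C * \<bar>x\<bar> powr (-1/4)"
proof -
  define I where "I = lam powr (- 1/4) / (1/4)"
  have I: "((\<lambda>\<xi>. (lam - \<xi>) powr (- 5/4)) has_integral I) {..0}"
    using has_integral_shifted_powr[OF assms, of "1/4"] by (simp add: I_def)
  have le: "norm (G_tilde lam x) \<le> I / pi * \<bar>x\<bar> powr (-1/4)" if x: "x \<noteq> 0" for x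
  proof -
    have bound: "norm (G_tilde_integrand lam x \<xi>) \<le> 2 * \<bar>x\<bar> powr (3/4) * (lam - \<xi>) powr (- 5/4)"
      if \<xi>: "\<xi> \<le> 0" for \<xi>
    proof -
      have "norm (exp (\<i> * complex_of_real (x * \<xi>)) - 1) \<le> 2 powr (1 - 3/4) * \<bar>x * \<xi>\<bar> powr (3/4)"
        by (rule min_le_powr[OF _ _ norm_exp_i_minus_one_le_2 norm_exp_i_minus_one_le]) auto
      \<comment> \<open>The constant 2^(1/4) is rounded up to 2, and |\<xi>| \<le> lam - \<xi>
        because \<xi> \<le> 0 < lam.\<close>
      also have "\<dots> \<le> 2 * (\<bar>x\<bar> powr (3/4) * (lam - \<xi>) powr (3/4))"
        unfolding abs_mult powr_mult
        using \<xi> assms powr_mono[of "1 - 3/4" 1 "2::real"] by (intro mult_mono powr_mono2) auto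
      finally have "norm (G_tilde_integrand lam x \<xi>) \<le>
          2 * (\<bar>x\<bar> powr (3/4) * (lam - \<xi>) powr (3/4)) * (1 / (\<xi> - lam)\<^sup>2)"
        unfolding G_tilde_integrand_def norm_divide norm_of_real by (simp add: divide_right_mono)
      also have "\<dots> = 2 * \<bar>x\<bar> powr (3/4) * (lam - \<xi>) powr (3/4 + (- 1 - 1))"
        unfolding powr_add shifted_square_conv_powr[OF assms \<xi>] by simp
      finally show ?thesis by simp
    qed
    have "norm (integral {..0} (G_tilde_integrand lam x)) \<le>
        integral {..0} (\<lambda>\<xi>. 2 * \<bar>x\<bar> powr (3/4) * (lam - \<xi>) powr (- 5/4))"
    proof (rule integral_norm_bound_integral)
      show "G_tilde_integrand lam x integrable_on {..0}"
        using G_tilde_integrand_absolutely_integrable[OF assms(1)] by (simp add: absolutely_integrable_on_def)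
      show "(\<lambda>\<xi>. 2 * \<bar>x\<bar> powr (3/4) * (lam - \<xi>) powr (- 5/4)) integrable_on {..0}"
        using has_integral_mult_right[OF I] by (auto simp: integrable_on_def)
    qed (use bound in auto)
    also have "\<dots> = 2 * \<bar>x\<bar> powr (3/4) * I"
      using has_integral_mult_right[OF I] by (rule integral_unique)
    finally have "norm (integral {..0} (G_tilde_integrand lam x)) / (2 * pi * \<bar>x\<bar>) \<le>
        2 * \<bar>x\<bar> powr (3/4) * I / (2 * pi * \<bar>x\<bar>)"
      by (rule divide_right_mono) simp
    moreover have "norm (G_tilde lam x) =
        norm (integral {..0} (G_tilde_integrand lam x)) / (2 * pi * \<bar>x\<bar>)"
      unfolding G_tilde_eq[OF assms x] norm_divide by (simp add: norm_mult)
    ultimately have "norm (G_tilde lam x) \<le> 2 * \<bar>x\<bar> powr (3/4) * I / (2 * pi * \<bar>x\<bar>)"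
      by simp
    also have "\<dots> = I / pi * (\<bar>x\<bar> powr (3/4) / \<bar>x\<bar> powr 1)"
      using x by simp
    also have "\<dots> = I / pi * \<bar>x\<bar> powr (-1/4)"
      unfolding powr_diff[symmetric] by simp
    finally show ?thesis .
  qed
  show ?thesis
  proof (rule exI[of _ "I / pi"], rule conjI)
    show "0 \<le> I / pi"
      unfolding I_def by (rule divide_nonneg_nonneg, rule divide_nonneg_nonneg) auto
    show "\<forall>x. x \<noteq> 0 \<longrightarrow> norm (G_tilde lam x) \<le> I / pi * \<bar>x\<bar> powr (-1/4)"
      using le by blast
  qed
qed

text \<open>Once 1 / x is split off, the integrand has an integrable majorant independent of x, so
  dominated convergence gives continuity on the whole line; only the division costs the
  origin.\<close>

lemma continuous_on_G_tilde:
  assumes "lam > 0"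
  shows "continuous_on (- {0}) (G_tilde lam)"
proof -
  have "continuous_on UNIV (\<lambda>x. integral {..0} (G_tilde_integrand lam x))"
    unfolding continuous_on_sequentially
  proof (intro allI ballI impI, elim conjE)
    fix X :: "nat \<Rightarrow> real" and x assume X: "X \<longlonglongrightarrow> x"
    show "((\<lambda>x. integral {..0} (G_tilde_integrand lam x)) \<circ> X) \<longlonglongrightarrow> integral {..0} (G_tilde_integrand lam x)"
      unfolding o_def
    proof (rule dominated_convergence(2))
      show "(\<lambda>\<xi>. 2 * (1 / (\<xi> - lam)\<^sup>2)) integrable_on {..0}"
        using has_integral_mult_right[OF has_integral_inverse_square[OF assms], of 2]
        by (auto simp: integrable_on_def)
      show "G_tilde_integrand lam (X k) integrable_on {..0}" for k
        using G_tilde_integrand_absolutely_integrable[OF assms(1)] by (simp add: absolutely_integrable_on_def)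
      fix \<xi> :: real
      show "norm (G_tilde_integrand lam (X k) \<xi>) \<le> 2 * (1 / (\<xi> - lam)\<^sup>2)" for k
        unfolding G_tilde_integrand_def norm_divide norm_of_real
        using norm_exp_i_minus_one_le_2[of "X k * \<xi>"] by (simp add: divide_right_mono)
      assume "\<xi> \<in> {..0}"
      thus "(\<lambda>k. G_tilde_integrand lam (X k) \<xi>) \<longlonglongrightarrow> G_tilde_integrand lam x \<xi>"
        unfolding G_tilde_integrand_def using assms by (intro tendsto_intros X) auto
    qed
  qed
  hence "continuous_on (-{0}) (\<lambda>x. integral {..0} (G_tilde_integrand lam x))"
    by (rule continuous_on_subset) simp
  hence "continuous_on (-{0}) (\<lambda>x. integral {..0} (G_tilde_integrand lam x) / (2 * complex_of_real pi * \<i> * complex_of_real x))"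
    by (intro continuous_intros) auto
  thus ?thesis
    by (rule continuous_on_cong[THEN iffD1, rotated 2]) (use assms in \<open>auto simp: G_tilde_eq\<close>)
qed

text \<open>Moves \<open>l\<close> from the integrand into the endpoint, where differentiation in
  \<open>l\<close> becomes the fundamental theorem of calculus.\<close>

lemma absolutely_integrable_shift_atMost:
  fixes f :: "real \<Rightarrow> complex"
  assumes "(\<lambda>\<xi>. f (\<xi> - l)) absolutely_integrable_on {..0}"
  shows "f absolutely_integrable_on {..-l}"
    and "integral {..-l} f = integral {..0} (\<lambda>\<xi>. f (\<xi> - l))"
proof -
  have ind: "indicator {..-l} (-l + 1 * x) *\<^sub>R f (-l + 1 * x) = indicator {..0} x *\<^sub>R f (x - l)" for x :: real
    by (auto simp: indicator_def)
  show 1: "f absolutely_integrable_on {..-l}"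
    using assms lebesgue_integrable_real_affine_iff[of 1 "\<lambda>x. indicator {..-l} x *\<^sub>R f x" "-l"]
    unfolding set_integrable_def ind by simp
  have "set_lebesgue_integral lebesgue {..-l} f = set_lebesgue_integral lebesgue {..0} (\<lambda>\<xi>. f (\<xi> - l))"
    using lebesgue_integral_real_affine[of 1 "\<lambda>x. indicator {..-l} x *\<^sub>R f x" "-l"]
    unfolding set_lebesgue_integral_def ind by simp
  thus "integral {..-l} f = integral {..0} (\<lambda>\<xi>. f (\<xi> - l))"
    using 1 assms by (simp add: set_lebesgue_integral_eq_integral)
qed

section \<open>Plane waves and the kernel conjugated by them\<close>

lemma norm_plane_wave [simp]: "norm (plane_wave lam x) = 1"
  by (simp add: plane_wave_def)

lemma plane_wave_nonzero [simp]: "plane_wave lam x \<noteq> 0"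
  by (simp add: plane_wave_def)

lemma cnj_plane_wave_mult [simp]: "cnj (plane_wave lam x) * plane_wave lam x = 1"
  by (simp add: plane_wave_def exp_cnj flip: exp_add)

lemma plane_wave_mult_cnj [simp]: "plane_wave lam x * cnj (plane_wave lam x) = 1"
  using cnj_plane_wave_mult[of lam x] by (simp only: mult.commute)

lemma plane_wave_diff: "plane_wave lam (x - y) = plane_wave lam x * cnj (plane_wave lam y)"
  by (simp add: plane_wave_def exp_cnj algebra_simps flip: exp_add)

lemma continuous_on_plane_wave [continuous_intros]: "continuous_on A (plane_wave lam)"
  unfolding plane_wave_def by (intro continuous_intros)

lemma borel_measurable_plane_wave [measurable]: "plane_wave lam \<in> borel_measurable borel"
  by (intro borel_measurable_continuous_onI continuous_on_plane_wave)

lemma norm_plane_wave_diff_le: "norm (plane_wave \<mu> z - plane_wave l z) \<le> \<bar>\<mu> - l\<bar> * \<bar>z\<bar>"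
proof -
  have "plane_wave \<mu> z - plane_wave l z = plane_wave l z * (exp (\<i> * complex_of_real ((\<mu> - l) * z)) - 1)"
    by (simp add: plane_wave_def algebra_simps flip: exp_add)
  thus ?thesis
    using norm_exp_i_minus_one_le[of "(\<mu> - l) * z"] by (simp only: norm_mult norm_plane_wave abs_mult mult_1)
qed

text \<open>For z \<noteq> 0 this is a jump term free of \<open>lam\<close> minus 1 / (2 \<pi>)
  times the improper integral of e^(i z \<eta>) / \<eta> over \<eta> \<le> -lam. As
  \<open>lam\<close> survives only in the endpoint, the derivative is elementary although the kernel
  is not.\<close>

definition reduced_kernel :: "real \<Rightarrow> real \<Rightarrow> complex" where
  "reduced_kernel lam z = cnj (plane_wave lam z) * G_minus lam z"

definition reduced_kernel_deriv :: "real \<Rightarrow> real \<Rightarrow> complex" where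
  "reduced_kernel_deriv lam z = - cnj (plane_wave lam z) / complex_of_real (2 * pi * lam)"

text \<open>Differentiates an integral with endpoint -lam. To stay with absolutely convergent
  integrals, this is done after the integration by parts, with e^(i z \<eta>) / \<eta>^2 in place of
  e^(i z \<eta>) / \<eta>.\<close>

lemma has_vector_derivative_reduced_kernel:
  assumes "lam > 0" "z \<noteq> 0"
  shows "((\<lambda>l. reduced_kernel l z) has_vector_derivative reduced_kernel_deriv lam z) (at lam)"
proof -
  define k where "k \<eta> = exp (\<i> * complex_of_real (z * \<eta>)) / complex_of_real (\<eta>\<^sup>2)" for \<eta>
  define W where "W l = integral {..-l} k" for l
  let ?X = "2 * complex_of_real pi * \<i> * complex_of_real z"
  have shifted: "(\<lambda>\<xi>. k (\<xi> - l)) = (\<lambda>\<xi>. cnj (plane_wave l z) *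
      (G_tilde_integrand l z \<xi> + complex_of_real (1 / (\<xi> - l)\<^sup>2)))" for l
  proof
    fix \<xi>
    have "exp (\<i> * complex_of_real (z * (\<xi> - l))) = cnj (plane_wave l z) * exp (\<i> * complex_of_real (z * \<xi>))"
      by (simp add: plane_wave_def exp_cnj algebra_simps flip: exp_add)
    thus "k (\<xi> - l) = cnj (plane_wave l z) *
      (G_tilde_integrand l z \<xi> + complex_of_real (1 / (\<xi> - l)\<^sup>2))"
      unfolding k_def G_tilde_integrand_def of_real_divide by (simp flip: add_divide_distrib)
  qed
  have sq: "((\<lambda>\<xi>. complex_of_real (1 / (\<xi> - l)\<^sup>2)) has_integral complex_of_real (1 / l)) {..0}"
    if "l > 0" for l
    by (rule has_integral_of_real[OF has_integral_inverse_square[OF that]])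
  have absk: "(\<lambda>\<xi>. k (\<xi> - l)) absolutely_integrable_on {..0}" if "l > 0" for l
  proof (rule measurable_bounded_by_integrable_imp_absolutely_integrable)
    show "(\<lambda>\<xi>. 1 / (\<xi> - l)\<^sup>2) integrable_on {..0}"
      using has_integral_inverse_square[OF that] by (auto simp: integrable_on_def)
    show "(\<lambda>\<xi>. k (\<xi> - l)) \<in> borel_measurable (lebesgue_on {..0})"
      unfolding k_def by (intro measurable_restrict_space1 measurable_completion) measurable
    show "norm (k (\<xi> - l)) \<le> 1 / (\<xi> - l)\<^sup>2" for \<xi>
      unfolding k_def norm_divide norm_of_real by simp
  qed auto
  note kW = absolutely_integrable_shift_atMost[OF absk]
  have W: "W l = cnj (plane_wave l z) * (integral {..0} (G_tilde_integrand l z) + complex_of_real (1 / l))"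
    if "l > 0" for l
  proof -
    have "G_tilde_integrand l z integrable_on {..0}"
      using G_tilde_integrand_absolutely_integrable[OF that] by (simp add: absolutely_integrable_on_def)
    from has_integral_mult_right[OF has_integral_add[OF integrable_integral[OF this] sq[OF that]]]
    show ?thesis
      unfolding W_def kW(2)[OF that] shifted by (rule integral_unique)
  qed
  \<comment> \<open>\<open>W\<close> contains the extra 1 / (\<xi> - l)^2 that removed the
    \<open>- 1\<close> of \<open>G_tilde_integrand\<close>; it integrates to 1 / l. Subtracting it
    restores the boundary term at \<eta> = -l.\<close>
  have R: "reduced_kernel l z = - \<i> * indicator {..<0} z - (W l - cnj (plane_wave l z) / complex_of_real l) / ?X"
    if "l > 0" for l
    unfolding reduced_kernel_def G_minus_def G_tilde_eq[OF that assms(2)] W[OF that]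
    using that assms(2) by (simp add: field_simps)
  have dW: "(W has_vector_derivative - k (- lam)) (at lam)"
  proof -
    \<comment> \<open>[c, d] has -lam in its interior and avoids the pole at 0, so \<open>k\<close>
      is continuous on it; the integral left of \<open>c\<close> does not depend on
      \<open>l\<close>.\<close>
    define c d where "c = - lam - 1" and "d = - lam / 2"
    have cont: "continuous_on {c..d} k"
      unfolding k_def using assms(1) by (intro continuous_intros) (auto simp: d_def)
    have "((\<lambda>u. integral {c..u} k) has_vector_derivative k (-lam)) (at (-lam) within {c..d})"
      using assms(1) by (intro integral_has_vector_derivative[OF cont]) (auto simp: c_def d_def)
    hence "((\<lambda>u. integral {c..u} k) has_vector_derivative k (-lam)) (at (-lam))"
      using assms(1) by (subst (asm) at_within_interior) (auto simp: c_def d_def)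
    hence "((\<lambda>u. integral {c..u} k) \<circ> uminus has_vector_derivative (-1) *\<^sub>R k (-lam)) (at lam)"
      by (intro vector_diff_chain_at) (auto intro!: derivative_eq_intros)
    from has_vector_derivative_add[OF has_vector_derivative_const[of "integral {..c} k"] this]
    have "((\<lambda>l. integral {..c} k + integral {c..-l} k) has_vector_derivative - k (-lam)) (at lam)"
      by (simp add: o_def)
    moreover have W_split: "W l = integral {..c} k + integral {c..-l} k" if "l \<in> {lam/2<..<lam+1}" for l
    proof -
      have "integral ({..c} \<union> {c..-l}) k = integral {..c} k + integral {c..-l} k"
      proof (rule integral_Un)
        have "0 < - c" using assms(1) by (simp add: c_def)
        from kW(1)[OF this] show "k integrable_on {..c}" by (simp add: absolutely_integrable_on_def)
        show "k integrable_on {c..-l}"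
          using that by (intro integrable_continuous_real continuous_on_subset[OF cont]) (auto simp: d_def)
        have "{..c} \<inter> {c..-l} \<subseteq> {c}" by auto
        thus "negligible ({..c} \<inter> {c..-l})" by (rule negligible_subset[rotated]) auto
      qed
      moreover have "{..c} \<union> {c..-l} = {..-l}" using that by (auto simp: c_def)
      ultimately show ?thesis by (simp add: W_def)
    qed
    ultimately show ?thesis
      using assms(1) by (elim has_vector_derivative_transform_within_open[where S="{lam/2<..<lam+1}"])
        (simp_all add: W_split)
  qed
  have dE: "((\<lambda>l. cnj (plane_wave l z)) has_vector_derivative (- \<i> * z * cnj (plane_wave lam z))) (at lam)"
  proof -
    have "((\<lambda>l. exp (- \<i> * z * l)) has_field_derivative (- \<i> * z * exp (- \<i> * z * complex_of_real lam))) (at (complex_of_real lam))"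
      by (auto intro!: derivative_eq_intros)
    from has_vector_derivative_real_field[OF this] show ?thesis
      by (simp add: plane_wave_def exp_cnj mult_ac)
  qed
  have dI: "((\<lambda>l. 1 / complex_of_real l) has_vector_derivative (- 1 / complex_of_real (lam\<^sup>2))) (at lam)"
  proof -
    have "((\<lambda>l. 1 / l) has_field_derivative (- 1 / (complex_of_real lam)\<^sup>2)) (at (complex_of_real lam))"
      using assms(1) by (auto intro!: derivative_eq_intros simp: power2_eq_square)
    from has_vector_derivative_real_field[OF this] show ?thesis by simp
  qed
  \<comment> \<open>Cancels the contribution of differentiating 1 / l. What remains comes from the
    exponential, and its factor z cancels against \<open>?X\<close>, so no singularity at z = 0 is
    left.\<close>
  have kl: "k (- lam) = cnj (plane_wave lam z) / complex_of_real (lam\<^sup>2)"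
    by (simp add: k_def plane_wave_def exp_cnj mult_ac)
  have "((\<lambda>l. - \<i> * indicator {..<0} z - (W l - cnj (plane_wave l z) * (1 / complex_of_real l)) / ?X)
      has_vector_derivative (0 - (- k (- lam) - (cnj (plane_wave lam z) * (- 1 / complex_of_real (lam\<^sup>2))
        + (- \<i> * z * cnj (plane_wave lam z)) * (1 / complex_of_real lam))) / ?X)) (at lam)"
    by (intro has_vector_derivative_diff has_vector_derivative_const has_vector_derivative_divide
        has_vector_derivative_mult dW dE dI)
  also have "(0 - (- k (- lam) - (cnj (plane_wave lam z) * (- 1 / complex_of_real (lam\<^sup>2))
        + (- \<i> * z * cnj (plane_wave lam z)) * (1 / complex_of_real lam))) / ?X) = reduced_kernel_deriv lam z"
    unfolding kl reduced_kernel_deriv_def using assms by (simp add: field_simps)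
  finally show ?thesis
    by (rule has_vector_derivative_transform_within_open[where S="{0<..}"])
       (use assms(1) in \<open>auto simp: R\<close>)
qed

lemma reduced_kernel_deriv_bounded:
  assumes "\<mu> \<ge> lam / 2" "lam > 0"
  shows "norm (reduced_kernel_deriv \<mu> z) \<le> 2 / lam"
proof -
  have "norm (reduced_kernel_deriv \<mu> z) = 1 / (2 * pi * \<mu>)"
    using assms by (simp add: reduced_kernel_deriv_def norm_divide norm_mult)
  also have "\<dots> \<le> 1 / (1 * (lam / 2))"
    using assms pi_gt3 by (intro divide_left_mono mult_mono) auto
  finally show ?thesis by simp
qed

text \<open>The weight enters here: changing the frequency of the plane wave costs |\<mu> - lam|
  |z|, changing 1 / lam costs no power of z. Keeping \<mu> \<ge> lam / 2 makes the constant depend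
  on \<open>lam\<close> alone.\<close>

lemma reduced_kernel_deriv_lipschitz:
  assumes "\<mu> \<ge> lam / 2" "lam > 0"
  shows "norm (reduced_kernel_deriv \<mu> z - reduced_kernel_deriv lam z) \<le> (2 / lam + 2 / lam\<^sup>2) * \<bar>\<mu> - lam\<bar> * weight z"
proof -
  have "\<mu> > 0" using assms by linarith
  have eq: "reduced_kernel_deriv \<mu> z - reduced_kernel_deriv lam z =
      - (cnj (plane_wave \<mu> z - plane_wave lam z) / complex_of_real \<mu>
        + cnj (plane_wave lam z) * complex_of_real (1 / \<mu> - 1 / lam)) / complex_of_real (2 * pi)"
    using assms(2) \<open>\<mu> > 0\<close> by (simp add: reduced_kernel_deriv_def field_simps)
  have "norm (cnj (plane_wave \<mu> z - plane_wave lam z) / complex_of_real \<mu>) \<le> (\<bar>\<mu> - lam\<bar> * \<bar>z\<bar>) / (lam / 2)"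
    unfolding norm_divide complex_mod_cnj
    using assms \<open>\<mu> > 0\<close> by (intro frac_le norm_plane_wave_diff_le) auto
  moreover have "norm (cnj (plane_wave lam z) * complex_of_real (1 / \<mu> - 1 / lam)) \<le> \<bar>\<mu> - lam\<bar> / (lam / 2 * lam)"
  proof -
    have "norm (cnj (plane_wave lam z) * complex_of_real (1 / \<mu> - 1 / lam)) = \<bar>1 / \<mu> - 1 / lam\<bar>"
      by (simp only: norm_mult complex_mod_cnj norm_plane_wave norm_of_real mult_1)
    also have "\<dots> = \<bar>\<mu> - lam\<bar> / (\<mu> * lam)"
      using assms(2) \<open>\<mu> > 0\<close> by (simp add: diff_frac_eq abs_minus_commute)
    also have "\<dots> \<le> \<bar>\<mu> - lam\<bar> / (lam / 2 * lam)"
      using assms by (intro divide_left_mono mult_mono) auto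
    finally show ?thesis .
  qed
  ultimately have num: "norm (- (cnj (plane_wave \<mu> z - plane_wave lam z) / complex_of_real \<mu>
        + cnj (plane_wave lam z) * complex_of_real (1 / \<mu> - 1 / lam)))
      \<le> (\<bar>\<mu> - lam\<bar> * \<bar>z\<bar>) / (lam / 2) + \<bar>\<mu> - lam\<bar> / (lam / 2 * lam)"
    unfolding norm_minus_cancel by (intro norm_triangle_le) simp
  have "norm (reduced_kernel_deriv \<mu> z - reduced_kernel_deriv lam z)
      \<le> ((\<bar>\<mu> - lam\<bar> * \<bar>z\<bar>) / (lam / 2) + \<bar>\<mu> - lam\<bar> / (lam / 2 * lam)) / 1"
    unfolding eq norm_divide using pi_gt3 assms by (intro frac_le num) auto
  also have "\<dots> = (2 / lam * \<bar>z\<bar> + 2 / lam\<^sup>2) * \<bar>\<mu> - lam\<bar>"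
    using assms(2) by (simp add: field_simps power2_eq_square)
  also have "\<dots> \<le> ((2 / lam + 2 / lam\<^sup>2) * weight z) * \<bar>\<mu> - lam\<bar>"
  proof (rule mult_right_mono)
    have "a * \<bar>z\<bar> + b \<le> (a + b) * weight z" if "0 \<le> a" "0 \<le> b" for a b
      using that by (simp add: weight_def algebra_simps)
    thus "2 / lam * \<bar>z\<bar> + 2 / lam\<^sup>2 \<le> (2 / lam + 2 / lam\<^sup>2) * weight z"
      using assms(2) by (meson divide_nonneg_pos less_eq_real_def zero_less_numeral zero_less_power)
  qed simp
  finally show ?thesis by (simp add: mult_ac)
qed

text \<open>The mean value inequality with a derivative bound that does not see z. It makes the
  convolution operators Lipschitz in \<open>lam\<close> in operator norm.\<close>

lemma norm_reduced_kernel_diff_le: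
  assumes "lam > 0" "\<bar>h\<bar> \<le> lam / 2" "z \<noteq> 0"
  shows "norm (reduced_kernel (lam + h) z - reduced_kernel lam z) \<le> 2 / lam * \<bar>h\<bar>"
proof -
  have "norm (reduced_kernel (lam + h) z - reduced_kernel lam z) \<le> 2 / lam * norm (lam + h - lam)"
  proof (rule differentiable_bound[where S="{lam/2..}"])
    fix \<mu> assume "\<mu> \<in> {lam/2..}"
    thus "((\<lambda>l. reduced_kernel l z) has_derivative (\<lambda>t. t *\<^sub>R reduced_kernel_deriv \<mu> z)) (at \<mu> within {lam/2..})"
      using has_vector_derivative_reduced_kernel[of \<mu> z] assms
      by (simp add: has_vector_derivative_def has_derivative_at_withinI)
    show "onorm (\<lambda>t. t *\<^sub>R reduced_kernel_deriv \<mu> z) \<le> 2 / lam"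
      using reduced_kernel_deriv_bounded[of lam \<mu> z] \<open>\<mu> \<in> _\<close> assms
      by (simp add: onorm_scaleR_left[OF bounded_linear_ident, simplified] onorm_id)
  qed (use assms in auto)
  thus ?thesis by simp
qed

text \<open>Interpolates between 4 / lam, uniform in z but without decay in h, and the linearisation
  error of order |h| \<open>weight z\<close>. The decay |h|^\<theta> is bought with only the power
  \<theta> of the weight.\<close>

lemma reduced_kernel_difference_quotient:
  assumes "lam > 0" "\<bar>h\<bar> \<le> lam / 2" "h \<noteq> 0" "z \<noteq> 0" "0 < \<theta>" "\<theta> \<le> 1"
  shows "norm ((reduced_kernel (lam + h) z - reduced_kernel lam z) / complex_of_real h - reduced_kernel_deriv lam z)
    \<le> (4 / lam) powr (1 - \<theta>) * (2 / lam + 2 / lam\<^sup>2) powr \<theta> * \<bar>h\<bar> powr \<theta> * weight z powr \<theta>"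
proof -
  let ?Q = "(reduced_kernel (lam + h) z - reduced_kernel lam z) / complex_of_real h"
  have "norm ?Q \<le> 2 / lam"
    using norm_reduced_kernel_diff_le[OF assms(1,2,4)] assms(3)
    by (simp add: norm_divide divide_le_eq)
  moreover have "norm (reduced_kernel_deriv lam z) \<le> 2 / lam"
    using assms(1) by (intro reduced_kernel_deriv_bounded) auto
  ultimately have 1: "norm (?Q - reduced_kernel_deriv lam z) \<le> 4 / lam"
    by (intro norm_triangle_le_diff) simp
  have "norm (reduced_kernel (lam + h) z - reduced_kernel lam z - (lam + h - lam) *\<^sub>R reduced_kernel_deriv lam z)
      \<le> norm (lam + h - lam) * ((2 / lam + 2 / lam\<^sup>2) * \<bar>h\<bar> * weight z)"
  proof (rule vector_differentiable_bound_linearization[where S="closed_segment lam (lam + h)"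
      and f="\<lambda>l. reduced_kernel l z" and f'="\<lambda>l. reduced_kernel_deriv l z"])
    have seg: "\<mu> \<ge> lam / 2" "\<bar>\<mu> - lam\<bar> \<le> \<bar>h\<bar>" if "\<mu> \<in> closed_segment lam (lam + h)" for \<mu>
      using that assms(2) by (auto simp: closed_segment_eq_real_ivl split: if_splits)
    fix \<mu> assume \<mu>: "\<mu> \<in> closed_segment lam (lam + h)"
    show "((\<lambda>l. reduced_kernel l z) has_vector_derivative reduced_kernel_deriv \<mu> z)
        (at \<mu> within closed_segment lam (lam + h))"
      using seg[OF \<mu>] assms
      by (intro has_vector_derivative_reduced_kernel[THEN has_vector_derivative_at_within]) auto
    have "norm (reduced_kernel_deriv \<mu> z - reduced_kernel_deriv lam z)
        \<le> (2 / lam + 2 / lam\<^sup>2) * \<bar>\<mu> - lam\<bar> * weight z"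
      using seg[OF \<mu>] assms by (intro reduced_kernel_deriv_lipschitz) auto
    also have "\<dots> \<le> (2 / lam + 2 / lam\<^sup>2) * \<bar>h\<bar> * weight z"
      using seg[OF \<mu>] assms(1) by (intro mult_mono mult_nonneg_nonneg) (auto simp: weight_def)
    finally show "norm (reduced_kernel_deriv \<mu> z - reduced_kernel_deriv lam z) \<le> (2 / lam + 2 / lam\<^sup>2) * \<bar>h\<bar> * weight z" .
  qed auto
  hence "norm (complex_of_real h * (?Q - reduced_kernel_deriv lam z)) \<le> \<bar>h\<bar> * ((2 / lam + 2 / lam\<^sup>2) * \<bar>h\<bar> * weight z)"
  proof -
    have "complex_of_real h * (?Q - reduced_kernel_deriv lam z) =
      reduced_kernel (lam + h) z - reduced_kernel lam z - (lam + h - lam) *\<^sub>R reduced_kernel_deriv lam z"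
    proof -
      have "c * (A / c - B) = A - c * B" if "c \<noteq> 0" for c A B :: complex
        using that by (simp add: field_simps)
      thus ?thesis using assms(3) by (simp add: scaleR_conv_of_real)
    qed
    moreover assume "norm (reduced_kernel (lam + h) z - reduced_kernel lam z - (lam + h - lam) *\<^sub>R reduced_kernel_deriv lam z)
      \<le> norm (lam + h - lam) * ((2 / lam + 2 / lam\<^sup>2) * \<bar>h\<bar> * weight z)"
    ultimately show ?thesis by simp
  qed
  hence 2: "norm (?Q - reduced_kernel_deriv lam z) \<le> (2 / lam + 2 / lam\<^sup>2) * \<bar>h\<bar> * weight z"
    using assms(3) unfolding norm_mult by simp
  have "norm (?Q - reduced_kernel_deriv lam z)
      \<le> (4 / lam) powr (1 - \<theta>) * ((2 / lam + 2 / lam\<^sup>2) * \<bar>h\<bar> * weight z) powr \<theta>"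
    using assms by (intro min_le_powr 1 2) (auto simp: weight_def)
  also have "\<dots> = (4 / lam) powr (1 - \<theta>) * (2 / lam + 2 / lam\<^sup>2) powr \<theta> * \<bar>h\<bar> powr \<theta> * weight z powr \<theta>"
    by (simp only: powr_mult mult.assoc)
  finally show ?thesis .
qed

section \<open>Operators that are contractions up to finitely many functionals\<close>

text \<open>One index at a time: a further subsequence keeps the limits already obtained.\<close>

lemma bounded_finite_family_convergent_subsequence:
  fixes f :: "'i \<Rightarrow> nat \<Rightarrow> 'a::heine_borel"
  assumes "finite S" "\<And>i. i \<in> S \<Longrightarrow> bounded (range (f i))"
  shows "\<exists>r. strict_mono r \<and> (\<forall>i\<in>S. convergent (f i \<circ> r))"
  using assms
proof (induction S)
  case empty
  show ?case by (auto intro: strict_mono_id)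
next
  case (insert j S)
  then obtain r where r: "strict_mono r" "\<forall>i\<in>S. convergent (f i \<circ> r)" by blast
  have "bounded (range (f j \<circ> r))"
    by (rule bounded_subset[OF insert.prems[of j]]) auto
  then obtain l q where q: "strict_mono q" "((f j \<circ> r) \<circ> q) \<longlonglongrightarrow> l"
    using bounded_imp_convergent_subsequence by blast
  have "convergent (f i \<circ> (r \<circ> q))" if "i \<in> insert j S" for i
  proof (cases "i = j")
    case True
    thus ?thesis using q(2) by (auto simp: convergent_def comp_assoc)
  next
    case False
    thus ?thesis
      using convergent_subseq_convergent[of "f i \<circ> r" q] r(2) q(1) that by (simp add: comp_assoc)
  qed
  with strict_mono_o[OF r(1) q(1)] show ?case by blast
qed

text \<open>The Riesz argument: if \<open>T\<close> is a contraction up to finitely many functionals, a sequence on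
  which \<open>1 - T\<close> tends to 0 is Cauchy along any subsequence on which these functionals converge.\<close>

lemma injective_imp_bounded_below:
  fixes T :: "'a::{real_normed_vector, complete_space} \<Rightarrow> 'a" and \<phi> :: "'i \<Rightarrow> 'a \<Rightarrow> 'b::{heine_borel, real_normed_vector}"
  assumes T: "bounded_linear T" and "finite S"
    and \<phi>: "\<And>i. i \<in> S \<Longrightarrow> bounded_linear (\<phi> i)"
    and est: "\<And>p. norm (T p) \<le> 1/2 * norm p + (\<Sum>i\<in>S. norm (\<phi> i p))"
    and inj: "\<And>p. T p = p \<Longrightarrow> p = 0"
  shows "\<exists>c>0. \<forall>p. norm p \<le> c * norm (p - T p)"
proof (rule ccontr)
  interpret T: bounded_linear T by (rule T)
  assume "\<not> ?thesis"
  hence "\<exists>p. norm p > real (Suc n) * norm (p - T p)" for n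
    by (metis linorder_not_less of_nat_0_less_iff zero_less_Suc)
  then obtain p where p: "\<And>n. norm (p n) > real (Suc n) * norm (p n - T (p n))" by metis
  have pos: "norm (p n) > 0" for n
    using p[of n] by (metis less_le_trans linorder_not_less mult_nonneg_nonneg norm_ge_zero of_nat_0_le_iff)
  define q where "q n = p n /\<^sub>R norm (p n)" for n
  have q1: "norm (q n) = 1" for n using pos[of n] by (simp add: q_def)
  have dq: "norm (q n - T (q n)) \<le> inverse (real (Suc n))" for n
  proof -
    have "q n - T (q n) = (p n - T (p n)) /\<^sub>R norm (p n)"
      by (simp add: q_def T.scaleR scaleR_diff_right)
    hence "norm (q n - T (q n)) = norm (p n - T (p n)) / norm (p n)"
      by (simp add: divide_inverse mult.commute)
    also have "\<dots> \<le> inverse (real (Suc n))"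
      using p[of n] pos[of n] by (simp add: field_simps del: of_nat_Suc)
    finally show ?thesis .
  qed
  have "bounded (range (\<lambda>n. \<phi> i (q n)))" if i: "i \<in> S" for i
  proof -
    obtain K where K: "\<And>x. norm (\<phi> i x) \<le> norm x * K"
      using bounded_linear.bounded[OF \<phi>[OF i]] by blast
    show ?thesis using K[of "q _"] q1 by (intro boundedI[of _ K]) auto
  qed
  then obtain r where r: "strict_mono r" "\<And>i. i \<in> S \<Longrightarrow> convergent ((\<lambda>n. \<phi> i (q n)) \<circ> r)"
    using bounded_finite_family_convergent_subsequence[OF \<open>finite S\<close>, of "\<lambda>i n. \<phi> i (q n)"] by blast
  define y where "y n = q (r n)" for n
  have "\<exists>L. \<forall>i\<in>S. (\<lambda>n. \<phi> i (y n)) \<longlonglongrightarrow> L i"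
    using r(2) by (intro bchoice) (auto simp: convergent_def y_def o_def)
  then obtain L where L: "\<And>i. i \<in> S \<Longrightarrow> (\<lambda>n. \<phi> i (y n)) \<longlonglongrightarrow> L i" by blast
  define d where "d n = y n - T (y n)" for n
  have "(\<lambda>n. q n - T (q n)) \<longlonglongrightarrow> 0"
    by (rule Lim_null_comparison[OF always_eventually LIMSEQ_inverse_real_of_nat]) (use dq in auto)
  hence d0: "d \<longlonglongrightarrow> 0"
    unfolding d_def y_def using LIMSEQ_subseq_LIMSEQ[OF _ r(1)] by (auto simp: o_def)
  \<comment> \<open>Collects all that tends to 0: the defect of \<open>y n\<close> and the distances
    of the functionals from their limits.\<close>
  define g where "g n = norm (d n) + (\<Sum>i\<in>S. norm (\<phi> i (y n) - L i))" for n
  have "g \<longlonglongrightarrow> norm (0::'a) + (\<Sum>i\<in>S. norm (L i - L i))"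
    unfolding g_def by (intro tendsto_intros d0 L)
  hence g0: "g \<longlonglongrightarrow> 0" by simp
  have diff: "norm (y m - y n) \<le> 2 * (g m + g n)" for m n
  proof -
    have "y m - y n = (d m - d n) + T (y m - y n)"
      by (simp add: d_def T.diff)
    hence "norm (y m - y n) \<le> norm (d m - d n) + norm (T (y m - y n))"
      by (metis norm_triangle_ineq)
    also have "\<dots> \<le> norm (d m) + norm (d n) + norm (T (y m - y n))"
      by (intro add_mono norm_triangle_ineq4 order_refl)
    \<comment> \<open>The half of norm (y m - y n) produced here is moved to the left at the end,
      whence the factor 2.\<close>
    also have "norm (T (y m - y n)) \<le> 1/2 * norm (y m - y n) + (\<Sum>i\<in>S. norm (\<phi> i (y m - y n)))"
      by (rule est)
    also have "(\<Sum>i\<in>S. norm (\<phi> i (y m - y n))) \<le>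
        (\<Sum>i\<in>S. norm (\<phi> i (y m) - L i) + norm (\<phi> i (y n) - L i))"
    proof (rule sum_mono)
      fix i assume "i \<in> S"
      hence "\<phi> i (y m - y n) = (\<phi> i (y m) - L i) - (\<phi> i (y n) - L i)"
        using bounded_linear.linear[OF \<phi>] linear_diff by fastforce
      thus "norm (\<phi> i (y m - y n)) \<le> norm (\<phi> i (y m) - L i) + norm (\<phi> i (y n) - L i)"
        by (metis norm_triangle_ineq4)
    qed
    finally show ?thesis by (simp add: g_def sum.distrib)
  qed
  have "Cauchy y"
  proof (rule CauchyI)
    fix e :: real assume "e > 0"
    with LIMSEQ_D[OF g0, of "e/4"] obtain N where N: "\<And>n. n \<ge> N \<Longrightarrow> norm (g n - 0) < e/4" by auto
    have "norm (y m - y n) < e" if "m \<ge> N" "n \<ge> N" for m n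
      using N[OF that(1)] N[OF that(2)] diff[of m n] by (simp add: abs_less_iff)
    thus "\<exists>M. \<forall>m\<ge>M. \<forall>n\<ge>M. norm (y m - y n) < e" by blast
  qed
  \<comment> \<open>The limit is a fixed point of \<open>T\<close>, hence 0, yet it has norm
    1.\<close>
  then obtain x where x: "y \<longlonglongrightarrow> x" using Cauchy_convergent_iff convergent_def by blast
  have "d \<longlonglongrightarrow> x - T x" unfolding d_def by (intro tendsto_diff x T.tendsto)
  hence "x - T x = 0" using d0 LIMSEQ_unique by blast
  hence "x = 0" using inj[of x] by simp
  moreover have "(\<lambda>n. norm (y n)) \<longlonglongrightarrow> norm x" by (intro tendsto_norm x)
  hence "norm x = 1" using q1 LIMSEQ_unique[OF _ tendsto_const] by (fastforce simp: y_def)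
  ultimately show False by simp
qed

section \<open>Convolution with weakly singular kernels\<close>

text \<open>The constant admits plane waves, which do not decay; the power admits the singularity of
  \<open>G_tilde\<close> with a square integrable near 0. The origin is exempt because the values of
  the kernels there are conventional.\<close>

definition mild_kernel :: "(real \<Rightarrow> complex) \<Rightarrow> bool" where
  "mild_kernel K \<longleftrightarrow> continuous_on (- {0}) K \<and>
     (\<exists>C\<ge>0. \<forall>z. z \<noteq> 0 \<longrightarrow> norm (K z) \<le> C * (1 + \<bar>z\<bar> powr (-1/4)))"

lemma mild_kernelI:
  assumes "continuous_on (- {0}) K" "0 \<le> C"
    "\<And>z. z \<noteq> 0 \<Longrightarrow> norm (K z) \<le> C * (1 + \<bar>z\<bar> powr (-1/4))"
  shows "mild_kernel K"
  using assms unfolding mild_kernel_def by blast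

lemma mild_kernelE:
  assumes "mild_kernel K"
  obtains C where "0 \<le> C" "\<And>z. z \<noteq> 0 \<Longrightarrow> norm (K z) \<le> C * (1 + \<bar>z\<bar> powr (-1/4))"
  using assms unfolding mild_kernel_def by blast

lemma mild_kernel_bounded:
  assumes "continuous_on (- {0}) K" "\<And>z. z \<noteq> 0 \<Longrightarrow> norm (K z) \<le> B"
  shows "mild_kernel K"
proof (rule mild_kernelI[OF assms(1), of "max 0 B"])
  fix z :: real assume "z \<noteq> 0"
  have "B \<le> max 0 B * 1" by simp
  also have "\<dots> \<le> max 0 B * (1 + \<bar>z\<bar> powr (-1/4))" by (intro mult_left_mono) auto
  finally show "norm (K z) \<le> max 0 B * (1 + \<bar>z\<bar> powr (-1/4))"
    using assms(2)[OF \<open>z \<noteq> 0\<close>] by linarith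
qed auto

lemma mild_kernel_mult:
  assumes "mild_kernel K" "continuous_on (- {0}) g" "\<And>z. z \<noteq> 0 \<Longrightarrow> norm (g z) \<le> 1"
  shows "mild_kernel (\<lambda>z. g z * K z)"
proof -
  obtain C where C: "0 \<le> C" "\<And>z. z \<noteq> 0 \<Longrightarrow> norm (K z) \<le> C * (1 + \<bar>z\<bar> powr (-1/4))"
    using mild_kernelE[OF assms(1)] by blast
  show ?thesis
  proof (rule mild_kernelI[OF _ C(1)])
    show "continuous_on (- {0}) (\<lambda>z. g z * K z)"
      using assms by (intro continuous_on_mult) (auto simp: mild_kernel_def)
    fix z :: real assume "z \<noteq> 0"
    have "norm (g z * K z) \<le> 1 * norm (K z)"
      unfolding norm_mult using assms(3)[OF \<open>z \<noteq> 0\<close>] by (intro mult_right_mono) auto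
    thus "norm (g z * K z) \<le> C * (1 + \<bar>z\<bar> powr (-1/4))"
      using C(2)[OF \<open>z \<noteq> 0\<close>] by simp
  qed
qed

lemma mild_kernel_add:
  assumes "mild_kernel K" "mild_kernel L"
  shows "mild_kernel (\<lambda>z. K z + L z)"
proof -
  obtain C where C: "0 \<le> C" "\<And>z. z \<noteq> 0 \<Longrightarrow> norm (K z) \<le> C * (1 + \<bar>z\<bar> powr (-1/4))"
    using mild_kernelE[OF assms(1)] by blast
  obtain D where D: "0 \<le> D" "\<And>z. z \<noteq> 0 \<Longrightarrow> norm (L z) \<le> D * (1 + \<bar>z\<bar> powr (-1/4))"
    using mild_kernelE[OF assms(2)] by blast
  show ?thesis
  proof (rule mild_kernelI[of _ "C + D"])
    show "continuous_on (- {0}) (\<lambda>z. K z + L z)"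
      using assms by (intro continuous_on_add) (auto simp: mild_kernel_def)
    fix z :: real assume "z \<noteq> 0"
    thus "norm (K z + L z) \<le> (C + D) * (1 + \<bar>z\<bar> powr (-1/4))"
      using norm_triangle_mono[OF C(2) D(2)] by (simp add: distrib_right)
  qed (use C D in auto)
qed

lemma mild_kernel_cmult:
  assumes "mild_kernel K"
  shows "mild_kernel (\<lambda>z. c * K z)"
proof -
  obtain C where C: "0 \<le> C" "\<And>z. z \<noteq> 0 \<Longrightarrow> norm (K z) \<le> C * (1 + \<bar>z\<bar> powr (-1/4))"
    using mild_kernelE[OF assms(1)] by blast
  show ?thesis
  proof (rule mild_kernelI[of _ "norm c * C"])
    show "continuous_on (- {0}) (\<lambda>z. c * K z)"
      using assms by (intro continuous_on_mult continuous_on_const) (auto simp: mild_kernel_def)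
  qed (use C in \<open>auto simp: norm_mult mult.assoc intro!: mult_left_mono\<close>)
qed

lemma mild_kernel_diff:
  assumes "mild_kernel K" "mild_kernel L"
  shows "mild_kernel (\<lambda>z. K z - L z)"
  using mild_kernel_add[OF assms(1) mild_kernel_cmult[OF assms(2), of "-1"]] by simp

lemma mild_kernel_plane_wave: "mild_kernel (plane_wave lam)"
  by (rule mild_kernel_bounded[OF continuous_on_plane_wave, of _ 1]) simp

lemma continuous_on_indicator_half_line: 
  "continuous_on (- {0}) (\<lambda>z::real. indicator {..<0} z :: complex)"
proof -
  have "isCont (\<lambda>z::real. indicator {..<0} z :: real) x" if "x \<noteq> 0" for x :: real
    using that by (intro isCont_indicator[THEN iffD2]) (auto simp: frontier_def interior_open)
  hence "isCont (\<lambda>z::real. complex_of_real (indicator {..<0} z)) x" if "x \<noteq> 0" for x :: real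
    using that by (intro isCont_of_real) auto
  thus ?thesis by (intro continuous_at_imp_continuous_on) (auto simp: of_real_indicator)
qed

lemma mild_kernel_G_minus:
  assumes "lam > 0"
  shows "mild_kernel (G_minus lam)"
proof -
  obtain C where C: "C \<ge> 0" "\<And>x. x \<noteq> 0 \<Longrightarrow> norm (G_tilde lam x) \<le> C * \<bar>x\<bar> powr (-1/4)"
    using norm_G_tilde_le[OF assms] by blast
  have "mild_kernel (G_tilde lam)"
  proof (rule mild_kernelI[OF continuous_on_G_tilde[OF assms] C(1)])
    fix z :: real assume "z \<noteq> 0"
    thus "norm (G_tilde lam z) \<le> C * (1 + \<bar>z\<bar> powr (-1/4))"
      using C(2)[of z] C(1) by (simp add: distrib_left)
  qed
  moreover have "mild_kernel (\<lambda>z. indicator {..<0} z)"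
    by (rule mild_kernel_bounded[OF continuous_on_indicator_half_line, of 1]) (simp add: indicator_def)
  hence "mild_kernel (\<lambda>z. plane_wave lam z * indicator {..<0} z)"
    by (rule mild_kernel_mult) (auto intro: continuous_on_plane_wave)
  hence "mild_kernel (\<lambda>z. - \<i> * (plane_wave lam z * indicator {..<0} z))"
    by (rule mild_kernel_cmult)
  ultimately have "mild_kernel (\<lambda>z. - \<i> * (plane_wave lam z * indicator {..<0} z) - G_tilde lam z)"
    by (intro mild_kernel_diff)
  thus ?thesis by (simp add: G_minus_def[abs_def] mult.assoc)
qed

lemma mild_kernel_reduced_kernel: "lam > 0 \<Longrightarrow> mild_kernel (reduced_kernel lam)"
  unfolding reduced_kernel_def[abs_def]
  by (rule mild_kernel_mult[OF mild_kernel_G_minus]) (auto intro!: continuous_on_cnj continuous_on_plane_wave)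

lemma mild_kernel_reduced_kernel_deriv: "mild_kernel (reduced_kernel_deriv lam)"
proof -
  have "mild_kernel (\<lambda>z. cnj (plane_wave lam z))"
    by (rule mild_kernel_bounded[of _ 1]) (auto intro!: continuous_on_cnj continuous_on_plane_wave)
  from mild_kernel_cmult[OF this, of "- 1 / complex_of_real (2 * pi * lam)"]
  show ?thesis by (simp add: reduced_kernel_deriv_def[abs_def])
qed

lemma mild_kernel_measurable:
  assumes "mild_kernel K"
  shows "K \<in> borel_measurable borel"
  using assms by (intro borel_measurable_continuous_countable_exceptions[of "{0}"]) (auto simp: mild_kernel_def)

lemma mild_kernel_measurable_translate:
  assumes "mild_kernel K"
  shows "(\<lambda>y. K (x - y)) \<in> borel_measurable lebesgue"
proof (rule measurable_completion)
  have "(\<lambda>y. K (x - y)) \<in> borel_measurable borel"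
    by (rule measurable_compose[OF _ mild_kernel_measurable[OF assms]]) measurable
  thus "(\<lambda>y. K (x - y)) \<in> borel_measurable lborel" by simp
qed

text \<open>An integrable majorant of the square of the singularity \<open>|z| powr (-1/4)\<close> near 0.\<close>

definition sing_sq :: "real \<Rightarrow> real" where
  "sing_sq z = indicator {0..1} z * z powr (-1/2) + indicator {0..1} (- z) * (- z) powr (-1/2)"

lemma sing_sq_nonneg: "sing_sq z \<ge> 0"
  by (simp add: sing_sq_def)

lemma sing_sq_measurable [measurable]: "sing_sq \<in> borel_measurable borel"
  unfolding sing_sq_def by measurable

lemma integrable_sing_sq: "integrable lebesgue sing_sq"
proof -
  have "((\<lambda>x. x powr (-1/2)) has_integral (1 powr (-1/2+1) / (-1/2+1))) {0..1::real}"
    by (rule has_integral_powr_from_0) auto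
  hence "(\<lambda>x::real. x powr (-1/2)) absolutely_integrable_on {0..1}"
    by (intro nonnegative_absolutely_integrable_1) (auto simp: integrable_on_def)
  hence 1: "integrable lebesgue (\<lambda>z::real. indicator {0..1} z * z powr (-1/2))"
    by (simp add: set_integrable_def)
  have "integrable lebesgue (\<lambda>z::real. indicator {0..1} (0 + (-1) * z) * (0 + (-1) * z) powr (-1/2))"
    by (rule lebesgue_integrable_real_affine[OF 1]) simp
  with 1 show ?thesis unfolding sing_sq_def by (intro Bochner_Integration.integrable_add) simp_all
qed

lemma integrable_sing_sq_translate: "integrable lebesgue (\<lambda>y. sing_sq (x - y))"
  using lebesgue_integrable_real_affine[OF integrable_sing_sq, of "-1" x] by simp

lemma integral_sing_sq_translate:
  "(LINT y|lebesgue. sing_sq (x - y)) = (LINT y|lebesgue. sing_sq y)"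
  using lebesgue_integral_real_affine[of "-1" sing_sq x] by simp

text \<open>Near 0 this is 2 a b \<le> a^2 + b^2, and away from 0 the power is at most 1. The right
  side separates density and singularity, so its integral over y does not depend on the centre
  x.\<close>

lemma singularity_mult_le:
  assumes "z \<noteq> 0" "a \<ge> 0"
  shows "(1 + \<bar>z\<bar> powr (-1/4)) * a \<le> 2 * a + a\<^sup>2 + sing_sq z"
proof (cases "\<bar>z\<bar> \<le> 1")
  case True
  have "\<bar>z\<bar> powr (-1/2) = (\<bar>z\<bar> powr (-1/4))\<^sup>2"
    using assms by (simp add: power2_eq_square flip: powr_add)
  hence "2 * (\<bar>z\<bar> powr (-1/4) * a) \<le> \<bar>z\<bar> powr (-1/2) + a\<^sup>2"
    using sum_squares_bound[of "\<bar>z\<bar> powr (-1/4)" a] by (simp add: mult.assoc)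
  moreover have "\<bar>z\<bar> powr (-1/2) \<le> sing_sq z"
    using True by (cases "z \<ge> 0") (simp_all add: sing_sq_def indicator_def)
  moreover have "0 \<le> \<bar>z\<bar> powr (-1/4) * a" using assms by simp
  ultimately show ?thesis unfolding distrib_right using assms(2) by linarith
next
  case False
  hence "\<bar>z\<bar> powr (-1/4) \<le> \<bar>z\<bar> powr 0" by (intro powr_mono) auto
  hence "\<bar>z\<bar> powr (-1/4) * a \<le> 1 * a" using False assms by (intro mult_right_mono) auto
  thus ?thesis using sing_sq_nonneg[of z] zero_le_power2[of a] unfolding distrib_right by linarith
qed

text \<open>The exceptions are the singularity and the two jumps of the cutoffs; being finitely
  many, they do not disturb convergence almost everywhere of translates.\<close>

lemma isCont_sing_sq:
  assumes "z \<notin> {0, 1, -1}"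
  shows "isCont sing_sq z"
proof -
  have "isCont (\<lambda>z. indicator {0..1} z * z powr (-1/2)) z" if "z \<notin> {0, 1}" for z :: real
    using that by (intro continuous_intros isCont_indicator[THEN iffD2]) (auto simp: frontier_def)
  hence "isCont (\<lambda>z. indicator {0..1} z * z powr (-1/2)) z"
    and "isCont (\<lambda>z. indicator {0..1} z * z powr (-1/2)) (- z)" using assms by auto
  thus ?thesis
    unfolding sing_sq_def[abs_def]
    using isCont_o2[where f=uminus and a=z and g="\<lambda>z. indicator {0..1} z * z powr (-1/2)"]
    by (intro isCont_add) (auto intro: continuous_minus)
qed

section \<open>Convolution with a density in L^1 and L^2\<close>

lemma AE_lebesgue_neq: "AE y in lebesgue. y \<noteq> (x::real)"
  by (rule AE_I[of _ _ "{x}"]) auto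

locale L1_L2_density =
  fixes v :: "real \<Rightarrow> complex"
  assumes v_measurable [measurable]: "v \<in> borel_measurable lebesgue"
    and v_integrable: "integrable lebesgue v"
    and v_sq_integrable: "integrable lebesgue (\<lambda>y. (norm (v y))\<^sup>2)"
begin

definition majorant :: "real \<Rightarrow> real \<Rightarrow> real" where
  "majorant x y = 2 * norm (v y) + (norm (v y))\<^sup>2 + sing_sq (x - y)"

text \<open>The integral of \<open>majorant x\<close>, the same for every \<open>x\<close> by
  translation invariance.\<close>

definition majorant_mass :: real where
  "majorant_mass = 2 * (LINT y|lebesgue. norm (v y)) + (LINT y|lebesgue. (norm (v y))\<^sup>2)
     + (LINT y|lebesgue. sing_sq y)"

text \<open>Covers the products u m with m in the weighted space, so that every estimate is reduced
  to one for \<open>v\<close> and is linear in \<open>B\<close>.\<close>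

definition dominated :: "(real \<Rightarrow> complex) \<Rightarrow> real \<Rightarrow> bool" where
  "dominated g B \<longleftrightarrow> g \<in> borel_measurable lebesgue \<and> B \<ge> 0 \<and> (AE y in lebesgue. norm (g y) \<le> B * norm (v y))"

lemma integrable_majorant: "integrable lebesgue (majorant x)"
  unfolding majorant_def
  by (intro Bochner_Integration.integrable_add integrable_mult_right integrable_norm v_integrable
      v_sq_integrable integrable_sing_sq_translate)

lemma integral_majorant: "(LINT y|lebesgue. majorant x y) = majorant_mass"
  unfolding majorant_def majorant_mass_def
  by (simp add: integrable_norm v_integrable v_sq_integrable integrable_sing_sq_translate integral_sing_sq_translate)

lemma majorant_nonneg: "0 \<le> majorant x y"
  by (simp add: majorant_def sing_sq_nonneg)

lemma majorant_mass_nonneg: "0 \<le> majorant_mass"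
  using integral_nonneg_AE[of "majorant 0" lebesgue] by (simp add: majorant_nonneg integral_majorant)

lemma kernel_le_majorant:
  assumes "\<And>z. z \<noteq> 0 \<Longrightarrow> norm (K z) \<le> C * (1 + \<bar>z\<bar> powr (-1/4))" "0 \<le> C" "y \<noteq> x"
  shows "norm (K (x - y)) * norm (v y) \<le> C * majorant x y"
proof -
  have "norm (K (x - y)) * norm (v y) \<le> C * (1 + \<bar>x - y\<bar> powr (-1/4)) * norm (v y)"
    using assms by (intro mult_right_mono) auto
  also have "\<dots> \<le> C * majorant x y"
    unfolding majorant_def mult.assoc using assms by (intro mult_left_mono singularity_mult_le) auto
  finally show ?thesis .
qed

lemma dominated_kernel_le_majorant:
  assumes "\<And>z. z \<noteq> 0 \<Longrightarrow> norm (K z) \<le> C * (1 + \<bar>z\<bar> powr (-1/4))" "0 \<le> C" "dominated g B"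
  shows "AE y in lebesgue. norm (K (x - y) * g y) \<le> B * C * majorant x y"
proof -
  have "B \<ge> 0" "AE y in lebesgue. norm (g y) \<le> B * norm (v y)"
    using assms(3) by (auto simp: dominated_def)
  from this(2) AE_lebesgue_neq[of x] show ?thesis
  proof eventually_elim
    case (elim y)
    have "norm (K (x - y) * g y) \<le> norm (K (x - y)) * (B * norm (v y))"
      unfolding norm_mult using elim by (intro mult_left_mono) auto
    also have "\<dots> = B * (norm (K (x - y)) * norm (v y))" by simp
    also have "\<dots> \<le> B * (C * majorant x y)"
      using elim assms \<open>B \<ge> 0\<close> by (intro mult_left_mono kernel_le_majorant) auto
    finally show ?case by simp
  qed
qed

lemma integrable_kernel_dominated:
  assumes "mild_kernel K" "dominated g B"
  shows "integrable lebesgue (\<lambda>y. K (x - y) * g y)"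
proof -
  obtain C where C: "0 \<le> C" "\<And>z. z \<noteq> 0 \<Longrightarrow> norm (K z) \<le> C * (1 + \<bar>z\<bar> powr (-1/4))"
    using mild_kernelE[OF assms(1)] by blast
  have [measurable]: "g \<in> borel_measurable lebesgue" using assms(2) by (simp add: dominated_def)
  have [measurable]: "(\<lambda>y. K (x - y)) \<in> borel_measurable lebesgue"
    by (rule mild_kernel_measurable_translate[OF assms(1)])
  show ?thesis
  proof (rule Bochner_Integration.integrable_bound)
    show "integrable lebesgue (\<lambda>y. B * C * majorant x y)"
      by (intro integrable_mult_right integrable_majorant)
    have "B \<ge> 0" using assms(2) by (simp add: dominated_def)
    show "AE y in lebesgue. norm (K (x - y) * g y) \<le> norm (B * C * majorant x y)"
    proof -
      have "AE y in lebesgue. norm (K (x - y) * g y) \<le> B * C * majorant x y"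
        by (rule dominated_kernel_le_majorant) (use C assms(2) in auto)
      thus ?thesis
        by eventually_elim (use \<open>B \<ge> 0\<close> C(1) in \<open>simp add: majorant_nonneg\<close>)
    qed
  qed measurable
qed

lemma norm_convolution_le:
  assumes "\<And>z. z \<noteq> 0 \<Longrightarrow> norm (K z) \<le> C * (1 + \<bar>z\<bar> powr (-1/4))" "0 \<le> C" "mild_kernel K" "dominated g B"
  shows "norm (convolution K g x) \<le> B * C * majorant_mass"
proof -
  have "norm (convolution K g x) \<le> (LINT y|lebesgue. norm (K (x - y) * g y))"
    unfolding convolution_def by (rule integral_norm_bound)
  also have "\<dots> \<le> (LINT y|lebesgue. B * C * majorant x y)"
    by (intro integral_mono_AE integrable_norm integrable_kernel_dominated[OF assms(3,4)] integrable_mult_right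
        integrable_majorant dominated_kernel_le_majorant assms)
  finally show ?thesis by (simp add: integral_majorant)
qed

lemma dominated_self: "dominated v 1"
  by (simp add: dominated_def)

lemma dominated_cmult:
  assumes "dominated g B"
  shows "dominated (\<lambda>y. c * g y) (norm c * B)"
proof -
  have [measurable]: "g \<in> borel_measurable lebesgue"
    using assms by (auto simp: dominated_def)
  have "AE y in lebesgue. norm (g y) \<le> B * norm (v y)"
    using assms by (auto simp: dominated_def)
  hence "AE y in lebesgue. norm (c * g y) \<le> norm c * B * norm (v y)"
    by eventually_elim (auto simp: norm_mult mult.assoc intro: mult_left_mono)
  thus ?thesis using assms by (auto simp: dominated_def)
qed

text \<open>Free of \<open>g\<close>: it controls the oscillation of all convolutions with a given
  bound \<open>B\<close> at once, which is what equicontinuity on bounded sets requires.\<close>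

definition translation_modulus :: "(real \<Rightarrow> complex) \<Rightarrow> real \<Rightarrow> real \<Rightarrow> real" where
  "translation_modulus K x x0 = (LINT y|lebesgue. norm (K (x - y) - K (x0 - y)) * norm (v y))"

lemma integrable_translation_modulus:
  assumes "mild_kernel K"
  shows "integrable lebesgue (\<lambda>y. norm (K (x - y) - K (x0 - y)) * norm (v y))"
proof -
  have "integrable lebesgue (\<lambda>y. norm (K (x - y) * v y - K (x0 - y) * v y))"
    by (intro integrable_norm Bochner_Integration.integrable_diff
        integrable_kernel_dominated[OF assms dominated_self])
  thus ?thesis by (simp flip: norm_mult left_diff_distrib)
qed

lemma convolution_diff_le:
  assumes "mild_kernel K" "dominated g B"
  shows "norm (convolution K g x - convolution K g x0) \<le> B * translation_modulus K x x0"
proof -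
  note int = integrable_kernel_dominated[OF assms]
  have "convolution K g x - convolution K g x0 = (LINT y|lebesgue. K (x - y) * g y - K (x0 - y) * g y)"
    unfolding convolution_def by (simp add: int)
  also have "norm \<dots> \<le> (LINT y|lebesgue. norm (K (x - y) * g y - K (x0 - y) * g y))"
    by (rule integral_norm_bound)
  also have "\<dots> \<le> (LINT y|lebesgue. B * (norm (K (x - y) - K (x0 - y)) * norm (v y)))"
  proof (intro integral_mono_AE integrable_norm Bochner_Integration.integrable_diff int
      integrable_mult_right integrable_translation_modulus assms)
    have "AE y in lebesgue. norm (g y) \<le> B * norm (v y)" using assms(2) by (auto simp: dominated_def)
    thus "AE y in lebesgue. norm (K (x - y) * g y - K (x0 - y) * g y)
        \<le> B * (norm (K (x - y) - K (x0 - y)) * norm (v y))"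
    proof eventually_elim
      case (elim y)
      have "norm (K (x - y) * g y - K (x0 - y) * g y) = norm (K (x - y) - K (x0 - y)) * norm (g y)"
        by (simp flip: norm_mult left_diff_distrib)
      also have "\<dots> \<le> norm (K (x - y) - K (x0 - y)) * (B * norm (v y))"
        using elim by (rule mult_left_mono) simp
      finally show ?case by (simp add: mult_ac)
    qed
  qed
  finally show ?thesis by (simp add: translation_modulus_def)
qed

text \<open>Dominated convergence does not apply directly, as the singularity moves with \<open>n\<close>; Scheffe's
  lemma controls the difference of the translated majorants.\<close>

lemma translation_modulus_tendsto_seq:
  assumes K: "mild_kernel K" and X: "X \<longlonglongrightarrow> x"
  shows "(\<lambda>n. translation_modulus K (X n) x) \<longlonglongrightarrow> 0"
proof -
  obtain C where C: "0 \<le> C" "\<And>z. z \<noteq> 0 \<Longrightarrow> norm (K z) \<le> C * (1 + \<bar>z\<bar> powr (-1/4))"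
    using mild_kernelE[OF K] by blast
  define h where "h n y = norm (K (X n - y) - K (x - y)) * norm (v y)" for n y
  define e where "e n y = \<bar>sing_sq (X n - y) - sing_sq (x - y)\<bar>" for n y
  \<comment> \<open>Splits h \<le> g + C e. Moving the singularity costs \<open>e\<close>, which is
    small in L^1; the excess \<open>g\<close> has a majorant that does not depend on n.\<close>
  define g where "g n y = max 0 (h n y - C * e n y)" for n y
  have int_h: "integrable lebesgue (h n)" for n
    unfolding h_def by (rule integrable_translation_modulus[OF K])
  have int_e: "integrable lebesgue (e n)" for n
    unfolding e_def by (intro integrable_abs Bochner_Integration.integrable_diff integrable_sing_sq_translate)
  have int_g: "integrable lebesgue (g n)" for n
    unfolding g_def by (intro integrable_max int_h int_e Bochner_Integration.integrable_diff integrable_mult_right) simp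
  \<comment> \<open>\<open>X n\<close> and \<open>x\<close> are the singularities of the two
    translated kernels, \<open>x - 1\<close> and \<open>x + 1\<close> the jumps of the translated
    \<open>sing_sq\<close>.\<close>
  have neq: "AE y in lebesgue. (\<forall>n. y \<noteq> X n) \<and> y \<noteq> x \<and> y \<noteq> x - 1 \<and> y \<noteq> x + 1"
    by (intro AE_conjI AE_all_countable[THEN iffD2] allI AE_lebesgue_neq)
  have e0: "(\<lambda>n. LINT y|lebesgue. e n y) \<longlonglongrightarrow> 0"
  proof -
    have "(\<lambda>n. \<integral>\<^sup>+ y. norm (sing_sq (X n - y) - sing_sq (x - y)) \<partial>lebesgue) \<longlonglongrightarrow> 0"
    \<comment> \<open>Translation preserves the integral of \<open>sing_sq\<close>, so the
      comparison of integrals demanded by this rule holds with equality.\<close>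
    proof (rule Scheffe_lemma2)
      show "(\<lambda>y. sing_sq (X n - y)) \<in> borel_measurable lebesgue" for n
        using integrable_sing_sq_translate by (rule borel_measurable_integrable)
      show "AE y in lebesgue. (\<lambda>n. sing_sq (X n - y)) \<longlonglongrightarrow> sing_sq (x - y)"
        using neq
      proof eventually_elim
        case (elim y)
        hence "isCont sing_sq (x - y)" by (intro isCont_sing_sq) auto
        thus ?case by (rule isCont_tendsto_compose) (intro tendsto_intros X)
      qed
      show "(\<integral>\<^sup>+ y. norm (sing_sq (X n - y)) \<partial>lebesgue) \<le> (\<integral>\<^sup>+ y. norm (sing_sq (x - y)) \<partial>lebesgue)" for n
        using nn_integral_eq_integral[OF integrable_sing_sq_translate, of x]
          nn_integral_eq_integral[OF integrable_sing_sq_translate, of "X n"]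
        by (simp add: sing_sq_nonneg integral_sing_sq_translate)
    qed (rule integrable_sing_sq_translate)
    moreover have "(\<integral>\<^sup>+ y. norm (sing_sq (X n - y) - sing_sq (x - y)) \<partial>lebesgue) = ennreal (LINT y|lebesgue. e n y)" for n
      unfolding real_norm_def e_def[symmetric] by (rule nn_integral_eq_integral[OF int_e]) (simp add: e_def)
    ultimately show ?thesis
      by (simp add: tendsto_ennreal_iff[of _ _ 0, simplified] e_def)
  qed
  have "(\<lambda>n. LINT y|lebesgue. g n y) \<longlonglongrightarrow> (LINT y|(lebesgue::real measure). 0)"
  proof (rule integral_dominated_convergence)
    show "integrable lebesgue (\<lambda>y. 2 * C * majorant x y)"
      by (intro integrable_mult_right integrable_majorant)
    show "AE y in lebesgue. (\<lambda>n. g n y) \<longlonglongrightarrow> 0"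
      using neq
    proof eventually_elim
      case (elim y)
      have "isCont K (x - y)"
        using K elim by (auto simp: mild_kernel_def continuous_on_eq_continuous_at open_Compl)
      hence "(\<lambda>n. K (X n - y)) \<longlonglongrightarrow> K (x - y)"
        by (rule isCont_tendsto_compose) (intro tendsto_intros X)
      hence "(\<lambda>n. h n y) \<longlonglongrightarrow> norm (K (x - y) - K (x - y)) * norm (v y)"
        unfolding h_def by (intro tendsto_intros)
      hence h0: "(\<lambda>n. h n y) \<longlonglongrightarrow> 0" by simp
      show ?case
      proof (rule tendsto_sandwich[OF _ _ tendsto_const h0])
        show "\<forall>\<^sub>F n in sequentially. 0 \<le> g n y" by (simp add: g_def)
        show "\<forall>\<^sub>F n in sequentially. g n y \<le> h n y"
          using C(1) by (intro always_eventually allI) (auto simp: g_def h_def e_def)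
      qed
    qed
    show "AE y in lebesgue. norm (g n y) \<le> 2 * C * majorant x y" for n
      using neq
    proof eventually_elim
      case (elim y)
      have "h n y \<le> (norm (K (X n - y)) + norm (K (x - y))) * norm (v y)"
        unfolding h_def by (intro mult_right_mono norm_triangle_ineq4) simp
      also have "\<dots> \<le> C * majorant (X n) y + C * majorant x y"
        unfolding distrib_right using elim C by (intro add_mono kernel_le_majorant) auto
      \<comment> \<open>The two majorants differ only in their \<open>sing_sq\<close> terms, so the
        moving one is replaced by the fixed one plus \<open>e\<close>.\<close>
      also have "C * majorant (X n) y \<le> C * (majorant x y + e n y)"
        using C(1) by (intro mult_left_mono) (auto simp: majorant_def e_def)
      finally have "h n y - C * e n y \<le> 2 * C * majorant x y" by (simp add: algebra_simps)
      thus ?case using C(1) majorant_nonneg[of x y] by (simp add: g_def)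
    qed
  qed (use int_g in auto)
  hence "(\<lambda>n. (LINT y|lebesgue. g n y) + C * (LINT y|lebesgue. e n y)) \<longlonglongrightarrow> 0 + C * 0"
    by (intro tendsto_intros e0) simp
  hence lim: "(\<lambda>n. (LINT y|lebesgue. g n y) + C * (LINT y|lebesgue. e n y)) \<longlonglongrightarrow> 0" by simp
  show ?thesis
  proof (rule tendsto_sandwich[OF _ _ tendsto_const lim])
    show "\<forall>\<^sub>F n in sequentially. 0 \<le> translation_modulus K (X n) x"
      unfolding translation_modulus_def by (intro always_eventually allI integral_nonneg) simp
    have "translation_modulus K (X n) x \<le> (LINT y|lebesgue. g n y + C * e n y)" for n
      unfolding translation_modulus_def h_def[symmetric]
      by (intro integral_mono int_h int_g int_e Bochner_Integration.integrable_add integrable_mult_right)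
         (simp add: g_def)
    thus "\<forall>\<^sub>F n in sequentially. translation_modulus K (X n) x
        \<le> (LINT y|lebesgue. g n y) + C * (LINT y|lebesgue. e n y)"
      using int_g int_e by (intro always_eventually allI) simp
  qed
qed

lemma translation_modulus_tendsto:
  assumes "mild_kernel K"
  shows "((\<lambda>x. translation_modulus K x x0) \<longlongrightarrow> 0) (at x0)"
  using translation_modulus_tendsto_seq[OF assms] unfolding LIMSEQ_SEQ_conv[symmetric] by blast

lemma convolution_isCont:
  assumes "mild_kernel K" "dominated g B"
  shows "isCont (convolution K g) x0"
proof -
  have "((\<lambda>x. convolution K g x - convolution K g x0) \<longlongrightarrow> 0) (at x0)"
  proof (rule Lim_null_comparison)
    show "\<forall>\<^sub>F x in at x0. norm (convolution K g x - convolution K g x0) \<le> B * translation_modulus K x x0"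
      by (intro always_eventually allI convolution_diff_le assms)
    show "((\<lambda>x. B * translation_modulus K x x0) \<longlongrightarrow> 0) (at x0)"
      by (intro tendsto_mult_right_zero translation_modulus_tendsto assms)
  qed
  thus ?thesis unfolding isCont_def by (simp add: LIM_zero_iff)
qed

end

section \<open>The weighted convolution operator\<close>

lemma weight_ge_1: "weight x \<ge> 1"
  by (simp add: weight_def)

lemma weight_pos [simp]: "weight x > 0"
  using weight_ge_1[of x] by linarith

lemma weight_nonzero [simp]: "weight x \<noteq> 0"
  using weight_pos[of x] by linarith

lemma continuous_on_weight_powr [continuous_intros]: "continuous_on A (\<lambda>x. weight x powr r)"
proof -
  have "continuous_on A weight" unfolding weight_def[abs_def] by (intro continuous_intros)
  thus ?thesis by (intro continuous_on_powr continuous_on_const) auto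
qed

lemma weight_powr_measurable [measurable]: "(\<lambda>x. weight x powr r) \<in> borel_measurable borel"
  by (intro borel_measurable_continuous_onI continuous_on_weight_powr)

lemma weight_powr_minus_mult [simp]: "weight x powr r * weight x powr (- r) = 1"
  by (simp flip: powr_add)

lemma weight_powr_minus_mult' [simp]: "weight x powr (- r) * weight x powr r = 1"
  by (simp flip: powr_add)

lemma weight_powr_neg_le_1: "r > 0 \<Longrightarrow> weight x powr (- r) \<le> 1"
  using powr_mono[of "- r" 0 "weight x"] weight_ge_1[of x] by simp

text \<open>Shares the growth of a kernel in x - y between the output weight and the
  density.\<close>

lemma weight_diff_le: "weight (x - y) \<le> weight x * weight y"
proof -
  have "weight (x - y) \<le> 1 + (\<bar>x\<bar> + \<bar>y\<bar>)" by (simp add: weight_def)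
  also have "\<dots> \<le> weight x * weight y" by (simp add: weight_def algebra_simps)
  finally show ?thesis .
qed

lemma weight_powr_tendsto_0:
  assumes "r > 0" "e > 0"
  shows "\<exists>R. \<forall>x. \<bar>x\<bar> > R \<longrightarrow> weight x powr (- r) < e"
proof -
  have lim: "((\<lambda>t::real. t powr (- r)) \<longlongrightarrow> 0) at_top"
    using assms by (intro tendsto_neg_powr filterlim_ident) auto
  obtain R where R: "\<And>t. t \<ge> R \<Longrightarrow> t powr (- r) < e"
    using order_tendstoD(2)[OF lim assms(2)] by (auto simp: eventually_at_top_linorder)
  show ?thesis
    by (intro exI[of _ R] allI impI R) (simp add: weight_def)
qed

lemma continuous_borel_measurable_lebesgue:
  "continuous_on UNIV g \<Longrightarrow> g \<in> borel_measurable lebesgue" for g :: "real \<Rightarrow> complex"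
  by (intro measurable_completion) (simp add: borel_measurable_continuous_onI)

lemma bcontfun_measurable_lebesgue: "apply_bcontfun p \<in> borel_measurable lebesgue"
  for p :: "real \<Rightarrow>\<^sub>C complex"
  by (intro continuous_borel_measurable_lebesgue) simp

text \<open>A nonempty open set is not negligible.\<close>

lemma AE_zero_continuous_imp_zero:
  fixes g :: "real \<Rightarrow> 'a::real_normed_vector"
  assumes "continuous_on UNIV g" "AE x in lebesgue. g x = 0"
  shows "g x = 0"
proof (rule ccontr)
  assume "g x \<noteq> 0"
  have "open {x. g x \<noteq> 0}"
    by (rule open_Collect_neq) (use assms(1) in auto)
  moreover have "negligible {x. g x \<noteq> 0}"
    using assms(2) by (auto simp: eventually_ae_filter_negligible intro: negligible_subset)
  ultimately show False using \<open>g x \<noteq> 0\<close> open_not_negligible by blast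
qed

locale weighted_density = L1_L2_density +
  fixes \<delta> :: real
  assumes \<delta>_pos: "\<delta> > 0"
begin

text \<open>Convolution conjugated by the weight: with n = w^\<delta> p and v = w^\<delta> u it is
  w^(-\<delta>) times the convolution of K with u n. Bounded continuous functions form a Banach
  space with genuine equality in place of equality almost everywhere. \<open>Bcontfun\<close> has
  its intended meaning only for bounded continuous arguments, hence the \<open>mild_kernel\<close>
  premises below.\<close>

definition weighted_convolution :: "(real \<Rightarrow> complex) \<Rightarrow> (real \<Rightarrow>\<^sub>C complex) \<Rightarrow> (real \<Rightarrow>\<^sub>C complex)" where
  "weighted_convolution K p = Bcontfun (\<lambda>x. complex_of_real (weight x powr (- \<delta>)) *
     convolution K (\<lambda>y. v y * apply_bcontfun p y) x)"

lemma dominated_bcontfun: "dominated (\<lambda>y. v y * apply_bcontfun p y) (norm p)"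
proof -
  have [measurable]: "apply_bcontfun p \<in> borel_measurable lebesgue" by (rule bcontfun_measurable_lebesgue)
  have "norm (v y * apply_bcontfun p y) \<le> norm p * norm (v y)" for y
    unfolding norm_mult by (subst mult.commute, rule mult_right_mono[OF norm_bounded]) simp
  thus ?thesis unfolding dominated_def by simp
qed

lemma norm_weight_mult_le: "norm (complex_of_real (weight x powr (- \<delta>)) * z) \<le> norm z"
  using mult_right_mono[OF weight_powr_neg_le_1[OF \<delta>_pos], of "norm z" x] by (simp add: norm_mult)

lemma weighted_bcontfunI:
  assumes "continuous_on UNIV g" "\<And>x. norm (g x) \<le> b"
  shows "(\<lambda>x. complex_of_real (weight x powr (- \<delta>)) * g x) \<in> bcontfun"
proof (rule bcontfun_normI)
  show "continuous_on UNIV (\<lambda>x. complex_of_real (weight x powr (- \<delta>)) * g x)"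
    by (intro continuous_on_mult continuous_on_of_real continuous_on_weight_powr assms)
  show "norm (complex_of_real (weight x powr (- \<delta>)) * g x) \<le> b" for x
    using norm_weight_mult_le[of x "g x"] assms(2)[of x] by linarith
qed

lemma convolution_continuous_bounded:
  assumes "mild_kernel K" "dominated g B"
  shows "continuous_on UNIV (convolution K g)" "\<exists>b. \<forall>x. norm (convolution K g x) \<le> b"
proof -
  show "continuous_on UNIV (convolution K g)"
    using convolution_isCont[OF assms] by (intro continuous_at_imp_continuous_on) auto
  obtain C where C: "0 \<le> C" "\<And>z. z \<noteq> 0 \<Longrightarrow> norm (K z) \<le> C * (1 + \<bar>z\<bar> powr (-1/4))"
    using mild_kernelE[OF assms(1)] by blast
  show "\<exists>b. \<forall>x. norm (convolution K g x) \<le> b"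
    using norm_convolution_le[OF _ C(1) assms] C(2) by blast
qed

lemma apply_weighted_convolution:
  assumes "mild_kernel K"
  shows "apply_bcontfun (weighted_convolution K p) x =
    complex_of_real (weight x powr (- \<delta>)) * convolution K (\<lambda>y. v y * apply_bcontfun p y) x"
proof -
  obtain b where "\<And>x. norm (convolution K (\<lambda>y. v y * apply_bcontfun p y) x) \<le> b"
    using convolution_continuous_bounded(2)[OF assms dominated_bcontfun] by blast
  hence "(\<lambda>x. complex_of_real (weight x powr (- \<delta>)) * convolution K (\<lambda>y. v y * apply_bcontfun p y) x) \<in> bcontfun"
    by (intro weighted_bcontfunI[where b=b] convolution_continuous_bounded(1)[OF assms dominated_bcontfun])
  thus ?thesis unfolding weighted_convolution_def by (simp add: Bcontfun_inverse)
qed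

lemma norm_weighted_convolution_le:
  assumes "mild_kernel K" "\<And>z. z \<noteq> 0 \<Longrightarrow> norm (K z) \<le> C * (1 + \<bar>z\<bar> powr (-1/4))" "0 \<le> C"
  shows "norm (weighted_convolution K p) \<le> C * majorant_mass * norm p"
proof (rule norm_bound)
  fix x
  have "norm (apply_bcontfun (weighted_convolution K p) x) \<le> norm (convolution K (\<lambda>y. v y * apply_bcontfun p y) x)"
    unfolding apply_weighted_convolution[OF assms(1)] by (rule norm_weight_mult_le)
  also have "\<dots> \<le> norm p * C * majorant_mass"
    by (rule norm_convolution_le[OF _ assms(3,1) dominated_bcontfun]) (rule assms(2))
  finally show "norm (apply_bcontfun (weighted_convolution K p) x) \<le> C * majorant_mass * norm p"
    by (simp add: mult_ac)
qed

lemma norm_weighted_convolution_le_bounded: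
  assumes "continuous_on (- {0}) K" "\<And>z. z \<noteq> 0 \<Longrightarrow> norm (K z) \<le> C" "0 \<le> C"
  shows "norm (weighted_convolution K p) \<le> C * majorant_mass * norm p"
proof (rule norm_weighted_convolution_le[OF mild_kernel_bounded[OF assms(1,2)]])
  fix z :: real assume "z \<noteq> 0"
  have "C * 1 \<le> C * (1 + \<bar>z\<bar> powr (-1/4))" using assms(3) by (intro mult_left_mono) auto
  thus "norm (K z) \<le> C * (1 + \<bar>z\<bar> powr (-1/4))" using assms(2)[OF \<open>z \<noteq> 0\<close>] by simp
qed (use assms in auto)

lemma convolution_add:
  assumes "mild_kernel K" "dominated g B" "dominated h D"
  shows "convolution K (\<lambda>y. g y + h y) x = convolution K g x + convolution K h x"
  unfolding convolution_def distrib_left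
  by (rule Bochner_Integration.integral_add[OF integrable_kernel_dominated[OF assms(1,2)]
        integrable_kernel_dominated[OF assms(1,3)]])

lemma convolution_cmult: "convolution K (\<lambda>y. c * g y) x = c * convolution K g x"
proof -
  have "(\<lambda>y. K (x - y) * (c * g y)) = (\<lambda>y. c * (K (x - y) * g y))" by (simp add: mult_ac)
  thus ?thesis unfolding convolution_def by simp
qed

lemma convolution_diff_kernel:
  assumes "mild_kernel K" "mild_kernel L" "dominated g B"
  shows "convolution (\<lambda>z. K z - L z) g x = convolution K g x - convolution L g x"
  unfolding convolution_def left_diff_distrib
  by (intro Bochner_Integration.integral_diff integrable_kernel_dominated[OF _ assms(3)] assms(1,2))

lemma convolution_cmult_kernel: "convolution (\<lambda>z. c * K z) g x = c * convolution K g x"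
  unfolding convolution_def mult.assoc by simp

lemma convolution_cong_AE:
  assumes "AE y in lebesgue. g y = h y" "g \<in> borel_measurable lebesgue" "h \<in> borel_measurable lebesgue"
    and "mild_kernel K"
  shows "convolution K g x = convolution K h x"
proof -
  have [measurable]: "(\<lambda>y. K (x - y)) \<in> borel_measurable lebesgue"
    by (rule mild_kernel_measurable_translate[OF assms(4)])
  note [measurable] = assms(2,3)
  have "AE y in lebesgue. K (x - y) * g y = K (x - y) * h y"
    using assms(1) by eventually_elim simp
  thus ?thesis unfolding convolution_def by (intro integral_cong_AE) measurable
qed

lemma bounded_linear_weighted_convolution:
  assumes "mild_kernel K"
  shows "bounded_linear (weighted_convolution K)"
proof -
  obtain C where C: "0 \<le> C" "\<And>z. z \<noteq> 0 \<Longrightarrow> norm (K z) \<le> C * (1 + \<bar>z\<bar> powr (-1/4))"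
    using mild_kernelE[OF assms] by blast
  show ?thesis
  proof (rule bounded_linear_intro)
    show "weighted_convolution K (p + q) = weighted_convolution K p + weighted_convolution K q" for p q
      by (rule bcontfun_eqI)
         (simp add: apply_weighted_convolution[OF assms] distrib_left
           convolution_add[OF assms dominated_bcontfun dominated_bcontfun])
    show "weighted_convolution K (r *\<^sub>R p) = r *\<^sub>R weighted_convolution K p" for r p
      using convolution_cmult[of K "complex_of_real r" "\<lambda>y. v y * apply_bcontfun p y"]
      by (intro bcontfun_eqI) (simp add: apply_weighted_convolution[OF assms] scaleR_conv_of_real mult_ac)
    show "norm (weighted_convolution K p) \<le> norm p * (C * majorant_mass)" for p
      using norm_weighted_convolution_le[OF assms C(2,1), of p] by (simp add: mult_ac)
  qed
qed

lemma weighted_convolution_diff_kernel: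
  assumes "mild_kernel K" "mild_kernel L"
  shows "weighted_convolution (\<lambda>z. K z - L z) p = weighted_convolution K p - weighted_convolution L p"
  by (rule bcontfun_eqI)
     (simp add: apply_weighted_convolution assms mild_kernel_diff right_diff_distrib
        convolution_diff_kernel[OF assms dominated_bcontfun])

lemma weighted_convolution_cmult_kernel:
  assumes "mild_kernel K"
  shows "weighted_convolution (\<lambda>z. complex_of_real c * K z) p = c *\<^sub>R weighted_convolution K p"
  by (rule bcontfun_eqI)
     (simp add: apply_weighted_convolution[OF assms] apply_weighted_convolution[OF mild_kernel_cmult[OF assms]]
        convolution_cmult_kernel scaleR_conv_of_real mult.left_commute)

text \<open>The point is that \<open>d\<close> is chosen before \<open>p\<close>: both sources of
  oscillation, the weight and the translated kernel, are bounded by a multiple of norm p.\<close>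

lemma weighted_convolution_equicontinuous:
  assumes "mild_kernel K" "e > 0"
  shows "\<exists>d>0. \<forall>x. \<bar>x - x0\<bar> < d \<longrightarrow> (\<forall>p. norm (apply_bcontfun (weighted_convolution K p) x -
           apply_bcontfun (weighted_convolution K p) x0) \<le> e * norm p)"
proof -
  obtain C where C: "0 \<le> C" "\<And>z. z \<noteq> 0 \<Longrightarrow> norm (K z) \<le> C * (1 + \<bar>z\<bar> powr (-1/4))"
    using mild_kernelE[OF assms(1)] by blast
  define M where "M x = \<bar>weight x powr (- \<delta>) - weight x0 powr (- \<delta>)\<bar> * (C * majorant_mass)
    + translation_modulus K x x0" for x
  have bound: "norm (apply_bcontfun (weighted_convolution K p) x -
           apply_bcontfun (weighted_convolution K p) x0) \<le> M x * norm p" for x p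
  proof -
    let ?w = "\<lambda>x. complex_of_real (weight x powr (- \<delta>))"
    let ?g = "\<lambda>y. v y * apply_bcontfun p y"
    have "norm (?w x * convolution K ?g x - ?w x0 * convolution K ?g x0) =
        norm ((?w x - ?w x0) * convolution K ?g x + ?w x0 * (convolution K ?g x - convolution K ?g x0))"
      by (simp add: algebra_simps)
    also have "\<dots> \<le> norm (?w x - ?w x0) * norm (convolution K ?g x) +
        norm (convolution K ?g x - convolution K ?g x0)"
      using norm_weight_mult_le by (intro norm_triangle_le add_mono) (auto simp: norm_mult)
    also have "norm (?w x - ?w x0) = \<bar>weight x powr (- \<delta>) - weight x0 powr (- \<delta>)\<bar>"
      by (simp flip: of_real_diff del: of_real_diff)
    also have "\<bar>weight x powr (- \<delta>) - weight x0 powr (- \<delta>)\<bar> * norm (convolution K ?g x) \<le>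
        \<bar>weight x powr (- \<delta>) - weight x0 powr (- \<delta>)\<bar> * (norm p * C * majorant_mass)"
      by (intro mult_left_mono norm_convolution_le[OF _ C(1) assms(1) dominated_bcontfun] C) auto
    also have "norm (convolution K ?g x - convolution K ?g x0) \<le> norm p * translation_modulus K x x0"
      by (intro convolution_diff_le assms(1) dominated_bcontfun)
    finally show ?thesis
      by (simp add: apply_weighted_convolution[OF assms(1)] M_def algebra_simps)
  qed
  have w: "((\<lambda>x. weight x powr (- \<delta>)) \<longlongrightarrow> weight x0 powr (- \<delta>)) (at x0)"
    using continuous_on_weight_powr[of UNIV "- \<delta>"] by (simp add: continuous_on_def)
  have "(M \<longlongrightarrow> \<bar>weight x0 powr (- \<delta>) - weight x0 powr (- \<delta>)\<bar> * (C * majorant_mass) + 0) (at x0)"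
    unfolding M_def by (intro tendsto_add tendsto_mult tendsto_rabs tendsto_diff tendsto_const w
        translation_modulus_tendsto assms(1))
  hence "(M \<longlongrightarrow> 0) (at x0)" by simp
  hence "\<forall>\<^sub>F x in at x0. M x < e" using assms(2) by (rule order_tendstoD)
  then obtain d where d: "d > 0" "\<And>x. x \<noteq> x0 \<Longrightarrow> dist x x0 < d \<Longrightarrow> M x < e"
    unfolding eventually_at by auto
  show ?thesis
  proof (intro exI[of _ d] conjI allI impI d(1))
    fix x p assume "\<bar>x - x0\<bar> < d"
    show "norm (apply_bcontfun (weighted_convolution K p) x - apply_bcontfun (weighted_convolution K p) x0) \<le> e * norm p"
    proof (cases "x = x0")
      case False
      hence "M x < e" using d(2) \<open>\<bar>x - x0\<bar> < d\<close> by (simp add: dist_real_def)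
      thus ?thesis using bound[of p x] mult_right_mono[of "M x" e "norm p"] by (simp add: less_imp_le)
    qed (use assms(2) in simp)
  qed
qed

text \<open>Compactness in quantitative form. Beyond \<open>R\<close> the output weight makes the
  image at most half of norm p; on [-R, R] equicontinuity with tolerance 1/2 and a finite net reduce
  it to its values at the net points.\<close>

lemma weighted_convolution_contraction_up_to_finite:
  assumes "mild_kernel K"
  shows "\<exists>S. finite S \<and> (\<forall>p. norm (weighted_convolution K p) \<le>
     1/2 * norm p + (\<Sum>x\<in>S. norm (apply_bcontfun (weighted_convolution K p) x)))"
proof -
  obtain C where C: "0 \<le> C" "\<And>z. z \<noteq> 0 \<Longrightarrow> norm (K z) \<le> C * (1 + \<bar>z\<bar> powr (-1/4))"
    using mild_kernelE[OF assms(1)] by blast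
  \<comment> \<open>The \<open>+ 1\<close> makes \<open>A\<close> positive, so that 1 / (2 A) is an
    admissible threshold for the weight.\<close>
  define A where "A = C * majorant_mass + 1"
  have "A > 0" using C(1) majorant_mass_nonneg by (simp add: A_def add_nonneg_pos)
  obtain R where R: "\<And>x. \<bar>x\<bar> > R \<Longrightarrow> weight x powr (- \<delta>) < 1 / (2 * A)"
    using weight_powr_tendsto_0[OF \<delta>_pos, of "1 / (2 * A)"] \<open>A > 0\<close> by auto
  have "\<exists>d>0. \<forall>x. \<bar>x - x0\<bar> < d \<longrightarrow> (\<forall>p. norm (apply_bcontfun (weighted_convolution K p) x -
           apply_bcontfun (weighted_convolution K p) x0) \<le> 1/2 * norm p)" for x0
    by (rule weighted_convolution_equicontinuous[OF assms]) simp
  then obtain d where d: "\<And>x. d x > 0"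
    "\<And>x x0 p. \<bar>x - x0\<bar> < d x0 \<Longrightarrow> norm (apply_bcontfun (weighted_convolution K p) x -
           apply_bcontfun (weighted_convolution K p) x0) \<le> 1/2 * norm p"
    by metis
  have "\<exists>S. S \<subseteq> {-R..R} \<and> finite S \<and> {-R..R} \<subseteq> (\<Union>x\<in>S. ball x (d x))"
    by (rule compactE_image[of "{-R..R}" "{-R..R}" "\<lambda>x. ball x (d x)"]) (use d(1) in auto)
  then obtain S where S: "finite S" "{-R..R} \<subseteq> (\<Union>x\<in>S. ball x (d x))" by blast
  show ?thesis
  proof (intro exI[of _ S] conjI allI S(1) norm_bound)
    fix p x
    let ?T = "\<lambda>x. apply_bcontfun (weighted_convolution K p) x"
    have sum_nonneg: "0 \<le> (\<Sum>x\<in>S. norm (?T x))" by (intro sum_nonneg) simp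
    show "norm (?T x) \<le> 1/2 * norm p + (\<Sum>x\<in>S. norm (?T x))"
    proof (cases "\<bar>x\<bar> > R")
      case True
      have "norm (convolution K (\<lambda>y. v y * apply_bcontfun p y) x) \<le> norm p * C * majorant_mass"
        by (rule norm_convolution_le[OF _ C(1) assms dominated_bcontfun]) (rule C(2))
      also have "\<dots> \<le> A * norm p" by (simp add: A_def algebra_simps)
      finally have "norm (?T x) \<le> weight x powr (- \<delta>) * (A * norm p)"
        unfolding apply_weighted_convolution[OF assms] norm_mult by (simp add: mult_left_mono)
      also have "\<dots> \<le> 1 / (2 * A) * (A * norm p)"
        using R[OF True] \<open>A > 0\<close> by (intro mult_right_mono) auto
      also have "\<dots> = 1/2 * norm p" using \<open>A > 0\<close> by simp
      finally show ?thesis using sum_nonneg by linarith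
    next
      case False
      hence "x \<in> {-R..R}" by auto
      then obtain x0 where "x0 \<in> S" "x \<in> ball x0 (d x0)" using S(2) by blast
      hence x0: "x0 \<in> S" "\<bar>x - x0\<bar> < d x0" by (auto simp: dist_real_def abs_minus_commute)
      have "norm (?T x) \<le> norm (?T x - ?T x0) + norm (?T x0)"
        using norm_triangle_sub[of "?T x" "?T x0"] by linarith
      also have "norm (?T x - ?T x0) \<le> 1/2 * norm p" by (rule d(2)[OF x0(2)])
      also have "norm (?T x0) \<le> (\<Sum>x\<in>S. norm (?T x))"
        by (rule member_le_sum[OF x0(1) _ S(1)]) simp
      finally show ?thesis by simp
    qed
  qed
qed

lemma weighted_convolution_bounded_below:
  assumes "mild_kernel K" "\<And>p. weighted_convolution K p = p \<Longrightarrow> p = 0"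
  shows "\<exists>c>0. \<forall>p. norm p \<le> c * norm (p - weighted_convolution K p)"
proof -
  obtain S where S: "finite S" "\<And>p. norm (weighted_convolution K p) \<le>
     1/2 * norm p + (\<Sum>x\<in>S. norm (apply_bcontfun (weighted_convolution K p) x))"
    using weighted_convolution_contraction_up_to_finite[OF assms(1)] by blast
  have "bounded_linear (\<lambda>p::real \<Rightarrow>\<^sub>C complex. apply_bcontfun p x)" for x
    by (rule bounded_linear_intro[of _ 1]) (auto intro: norm_bounded)
  hence "bounded_linear (\<lambda>p. apply_bcontfun (weighted_convolution K p) x)" for x
    by (rule bounded_linear_compose[OF _ bounded_linear_weighted_convolution[OF assms(1)]])
  \<comment> \<open>The functionals of the Riesz argument are the values of the image at the net
    points.\<close>
  thus ?thesis
    by (intro injective_imp_bounded_below[where S=S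
          and \<phi>="\<lambda>x p. apply_bcontfun (weighted_convolution K p) x"]
        bounded_linear_weighted_convolution assms S)
qed

end

section \<open>The Jost solutions\<close>

lemma weight_powr_measurable_lebesgue [measurable]: "(\<lambda>x. weight x powr r) \<in> borel_measurable lebesgue"
  by (intro measurable_completion) simp

lemma plane_wave_measurable_lebesgue [measurable]: "plane_wave lam \<in> borel_measurable lebesgue"
  by (intro measurable_completion) simp

lemma cnj_measurable [measurable (raw)]:
  "g \<in> borel_measurable M \<Longrightarrow> (\<lambda>x. cnj (g x)) \<in> borel_measurable M"
  by (rule measurable_compose[of _ _ borel]) (auto intro!: borel_measurable_continuous_onI continuous_on_cnj)

lemma Linf_norm_le:
  assumes "m \<in> borel_measurable lebesgue" "AE x in lebesgue. weight x powr r * norm (m x) \<le> B"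
  shows "Linf_norm r m \<le> ennreal B"
proof -
  note [measurable] = assms(1)
  show ?thesis
    unfolding Linf_norm_def
  proof (rule esssup_I)
    show "AE x in lebesgue. ennreal (weight x powr r * norm (m x)) \<le> ennreal B"
      using assms(2) by eventually_elim (rule ennreal_leI)
  qed measurable
qed

lemma Linf_weightedI:
  assumes "m \<in> borel_measurable lebesgue" "AE x in lebesgue. weight x powr r * norm (m x) \<le> B"
  shows "m \<in> Linf_weighted r"
  using Linf_norm_le[OF assms] assms(1) ennreal_less_top[of B] order_le_less_trans
  unfolding Linf_weighted_def by fastforce

lemma Linf_weighted_measurable: "m \<in> Linf_weighted r \<Longrightarrow> m \<in> borel_measurable lebesgue"
  by (simp add: Linf_weighted_def)

lemma Linf_weighted_bound:
  assumes "m \<in> Linf_weighted r"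
  shows "\<exists>B\<ge>0. AE x in lebesgue. weight x powr r * norm (m x) \<le> B"
proof -
  define B where "B = enn2real (Linf_norm r m)"
  have fin: "Linf_norm r m = ennreal B"
    using assms by (simp add: B_def Linf_weighted_def less_top)
  have "AE x in lebesgue. ennreal (weight x powr r * norm (m x)) \<le> ennreal B"
    unfolding fin[symmetric] Linf_norm_def by (rule esssup_AE)
  hence "AE x in lebesgue. weight x powr r * norm (m x) \<le> B"
    by eventually_elim (simp add: B_def ennreal_le_iff)
  thus ?thesis by (intro exI[of _ B]) (simp add: B_def)
qed

lemma Linf_weighted_add:
  assumes "m \<in> Linf_weighted r" "n \<in> Linf_weighted r"
  shows "(\<lambda>x. m x + n x) \<in> Linf_weighted r"
proof -
  note [measurable] = assms[THEN Linf_weighted_measurable]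
  obtain B C where "AE x in lebesgue. weight x powr r * norm (m x) \<le> B"
    "AE x in lebesgue. weight x powr r * norm (n x) \<le> C"
    using assms[THEN Linf_weighted_bound] by blast
  hence "AE x in lebesgue. weight x powr r * norm (m x + n x) \<le> B + C"
  proof eventually_elim
    case (elim x)
    have "weight x powr r * norm (m x + n x) \<le> weight x powr r * (norm (m x) + norm (n x))"
      by (intro mult_left_mono norm_triangle_ineq) simp
    thus ?case using elim by (simp add: distrib_left)
  qed
  thus ?thesis by (intro Linf_weightedI) measurable
qed

lemma Linf_weighted_mult:
  assumes "m \<in> Linf_weighted r" "g \<in> borel_measurable lebesgue" "\<And>x. norm (g x) \<le> b"
  shows "(\<lambda>x. g x * m x) \<in> Linf_weighted r"
proof -
  note [measurable] = assms(1)[THEN Linf_weighted_measurable] assms(2)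
  obtain B where "AE x in lebesgue. weight x powr r * norm (m x) \<le> B"
    using assms(1)[THEN Linf_weighted_bound] by blast
  hence "AE x in lebesgue. weight x powr r * norm (g x * m x) \<le> b * B"
  proof eventually_elim
    case (elim x)
    have "b \<ge> 0" using assms(3)[of x] norm_ge_zero order_trans by blast
    have "weight x powr r * norm (g x * m x) = norm (g x) * (weight x powr r * norm (m x))"
      by (simp add: norm_mult)
    also have "\<dots> \<le> b * B" using elim assms(3)[of x] \<open>b \<ge> 0\<close> by (intro mult_mono) auto
    finally show ?case .
  qed
  thus ?thesis by (intro Linf_weightedI) measurable
qed

text \<open>On the negative half-line the weight is 1 - \<xi>, a shifted power already integrated;
  reflection covers the other half.\<close>

lemma integrable_weight_powr:
  assumes "q > 1"
  shows "integrable lebesgue (\<lambda>y. weight y powr (- q))"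
proof -
  have "((\<lambda>\<xi>. (1 - \<xi>) powr (- (q - 1) - 1)) has_integral (1 powr (- (q - 1)) / (q - 1))) {..0}"
    using assms by (intro has_integral_shifted_powr) auto
  hence "((\<lambda>\<xi>. weight \<xi> powr (- q)) has_integral (1 powr (- (q - 1)) / (q - 1))) {..0}"
    by (rule has_integral_eq[rotated]) (simp add: weight_def)
  hence "(\<lambda>\<xi>. weight \<xi> powr (- q)) absolutely_integrable_on {..0}"
    by (intro nonnegative_absolutely_integrable_1) (auto simp: integrable_on_def)
  hence 1: "integrable lebesgue (\<lambda>y::real. indicator {..0} y * weight y powr (- q))"
    by (simp add: set_integrable_def)
  have 2: "integrable lebesgue (\<lambda>y::real. indicator {..0} (0 + (-1) * y) * weight (0 + (-1) * y) powr (- q))"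
    by (rule lebesgue_integrable_real_affine[OF 1]) simp
  show ?thesis
  proof (rule Bochner_Integration.integrable_bound[OF Bochner_Integration.integrable_add[OF 1 2]])
    show "AE y in lebesgue. norm (weight y powr (- q)) \<le> norm (indicator {..0} y * weight y powr (- q) +
        indicator {..0} (0 + (-1) * y) * weight (0 + (-1) * y) powr (- q))"
      by (rule AE_I2) (auto simp: indicator_def weight_def)
  qed measurable
qed

section \<open>The potential and its weighted density\<close>

locale jost_potential =
  fixes s s1 :: real and u :: "real \<Rightarrow> real"
  assumes s_gt: "s > s1" and s1_gt: "s1 > 1/2" and u_L2: "u \<in> L2_weighted s"
begin

text \<open>Carries the weight that was divided out of the unknown: if m = w^(s - s1) p, then u m =
  v p.\<close>

definition v :: "real \<Rightarrow> complex" where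
  "v y = complex_of_real (u y * weight y powr (s - s1))"

lemma u_measurable [measurable]: "u \<in> borel_measurable lebesgue"
  using u_L2 by (simp add: L2_weighted_def)

lemma norm_v: "norm (v y) = \<bar>u y\<bar> * weight y powr (s - s1)"
  by (simp add: v_def abs_mult del: of_real_mult)

sublocale weighted_density v "s - s1"
proof
  have L2: "integrable lebesgue (\<lambda>y. (weight y powr s * u y)\<^sup>2)"
    using u_L2 by (simp add: L2_weighted_def)
  show [measurable]: "v \<in> borel_measurable lebesgue"
    unfolding v_def[abs_def] by measurable
  show "integrable lebesgue v"
  proof (rule Bochner_Integration.integrable_bound)
    show "integrable lebesgue (\<lambda>y. (weight y powr s * u y)\<^sup>2 + weight y powr (- (2 * s1)))"
      using s1_gt by (intro Bochner_Integration.integrable_add L2 integrable_weight_powr) auto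
    show "AE y in lebesgue. norm (v y) \<le> norm ((weight y powr s * u y)\<^sup>2 + weight y powr (- (2 * s1)))"
    proof (rule AE_I2)
      fix y
      \<comment> \<open>Splits w^(s - s1) |u| into w^s |u| and w^(-s1), both square integrable: the
        first by the hypothesis on \<open>u\<close>, the second by 2 s1 > 1.\<close>
      have "norm (v y) = \<bar>weight y powr s * u y\<bar> * weight y powr (- s1)"
        by (simp add: norm_v abs_mult powr_diff powr_minus_divide)
      also have "\<dots> \<le> \<bar>weight y powr s * u y\<bar>\<^sup>2 + (weight y powr (- s1))\<^sup>2"
      proof -
        have ab: "a * b \<le> a\<^sup>2 + b\<^sup>2" if "0 \<le> a" "0 \<le> b" for a b :: real
          using sum_squares_bound[of a b] mult_nonneg_nonneg[OF that] by linarith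
        show ?thesis by (rule ab) auto
      qed
      also have "(weight y powr (- s1))\<^sup>2 = weight y powr (- (2 * s1))"
        by (simp add: power2_eq_square flip: powr_add)
      finally show "norm (v y) \<le> norm ((weight y powr s * u y)\<^sup>2 + weight y powr (- (2 * s1)))"
        by simp
    qed
  qed measurable
  show "integrable lebesgue (\<lambda>y. (norm (v y))\<^sup>2)"
  proof (rule Bochner_Integration.integrable_bound[OF L2])
    show "AE y in lebesgue. norm ((norm (v y))\<^sup>2) \<le> norm ((weight y powr s * u y)\<^sup>2)"
    proof (rule AE_I2)
      fix y
      have "norm (v y) \<le> \<bar>u y\<bar> * weight y powr s"
        unfolding norm_v using s1_gt weight_ge_1[of y] by (intro mult_left_mono powr_mono) auto
      hence "(norm (v y))\<^sup>2 \<le> (\<bar>u y\<bar> * weight y powr s)\<^sup>2" by (rule power_mono) simp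
      thus "norm ((norm (v y))\<^sup>2) \<le> norm ((weight y powr s * u y)\<^sup>2)"
        by (simp add: power_mult_distrib mult.commute)
    qed
  qed measurable
  show "s - s1 > 0" using s_gt by simp
qed

abbreviation r :: real where "r \<equiv> - (s - s1)"

lemma weight_cancel: "complex_of_real (weight x powr (s - s1)) * (complex_of_real (weight x powr r) * z) = z"
  unfolding mult.assoc[symmetric] of_real_mult[symmetric] weight_powr_minus_mult by simp

lemma dominated_potential:
  assumes "m \<in> Linf_weighted r"
  shows "\<exists>B. dominated (\<lambda>y. complex_of_real (u y) * m y) B"
proof -
  note [measurable] = Linf_weighted_measurable[OF assms]
  obtain B where B: "B \<ge> 0" "AE x in lebesgue. weight x powr r * norm (m x) \<le> B"
    using Linf_weighted_bound[OF assms] by blast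
  from B(2) have "AE y in lebesgue. norm (complex_of_real (u y) * m y) \<le> B * norm (v y)"
  proof eventually_elim
    case (elim y)
    have "norm (complex_of_real (u y) * m y) = norm (v y) * (weight y powr r * norm (m y))"
      by (simp add: norm_v norm_mult mult.assoc[symmetric] flip: powr_add)
    also have "\<dots> \<le> norm (v y) * B" using elim by (rule mult_left_mono) simp
    finally show ?case by (simp add: mult.commute)
  qed
  with B(1) show ?thesis unfolding dominated_def by (intro exI[of _ B]) simp
qed

text \<open>Uniqueness is given only for the inhomogeneity \<open>g\<close> itself. Adding (1 - c) m
  to n produces a solution for exactly \<open>g\<close>, so it equals m. The case c = 0 is
  uniqueness for the homogeneous equation.\<close>

lemma unique_solution_scaled:
  assumes K: "mild_kernel K" and m: "unique_solution r u K g m" and n: "n \<in> Linf_weighted r"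
    and eq: "AE x in lebesgue. n x = c * g x + convolution K (\<lambda>y. complex_of_real (u y) * n y) x"
  shows "AE x in lebesgue. n x = c * m x"
proof -
  have m_Linf: "m \<in> Linf_weighted r"
    and m_eq: "AE x in lebesgue. m x = g x + convolution K (\<lambda>y. complex_of_real (u y) * m y) x"
    using m by (auto simp: unique_solution_def solves_def)
  define k where "k x = n x + (1 - c) * m x" for x
  have k_Linf: "k \<in> Linf_weighted r"
    unfolding k_def by (intro Linf_weighted_add n Linf_weighted_mult[OF m_Linf, of _ "norm (1 - c)"]) auto
  obtain B C where dom: "dominated (\<lambda>y. complex_of_real (u y) * n y) B"
    "dominated (\<lambda>y. complex_of_real (u y) * m y) C"
    using dominated_potential n m_Linf by metis
  have conv: "convolution K (\<lambda>y. complex_of_real (u y) * k y) x =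
      convolution K (\<lambda>y. complex_of_real (u y) * n y) x
      + (1 - c) * convolution K (\<lambda>y. complex_of_real (u y) * m y) x" for x
    using convolution_add[OF K dom(1) dominated_cmult[OF dom(2), of "1 - c"], of x]
    unfolding convolution_cmult by (simp add: k_def distrib_left mult_ac)
  from eq m_eq have "AE x in lebesgue. k x = g x + convolution K (\<lambda>y. complex_of_real (u y) * k y) x"
    unfolding conv by eventually_elim (simp add: k_def algebra_simps)
  with k_Linf have "solves r u K g k" by (simp add: solves_def)
  hence "AE x in lebesgue. k x = m x" using m by (simp add: unique_solution_def)
  thus ?thesis by eventually_elim (simp add: k_def algebra_simps)
qed

section \<open>Jump relations between the two boundary values\<close>

lemma mild_kernel_cong:
  assumes "mild_kernel K" "\<And>z. z \<noteq> 0 \<Longrightarrow> K z = L z"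
  shows "mild_kernel L"
  using assms continuous_on_cong[of "-{0}" "-{0}" K L] by (auto simp: mild_kernel_def)

lemma convolution_cong_kernel:
  assumes "mild_kernel K" "\<And>z. z \<noteq> 0 \<Longrightarrow> K z = L z" "g \<in> borel_measurable lebesgue"
  shows "convolution K g x = convolution L g x"
proof -
  have "mild_kernel L"
    by (rule mild_kernel_cong[OF assms(1,2)])
  note [measurable] = mild_kernel_measurable_translate[OF assms(1)] mild_kernel_measurable_translate[OF this]
    assms(3)
  show ?thesis
    unfolding convolution_def
  proof (rule integral_cong_AE)
    show "AE y in lebesgue. K (x - y) * g y = L (x - y) * g y"
      using AE_lebesgue_neq[of x] by eventually_elim (use assms(2) in auto)
  qed measurable
qed

lemma convolution_plane_wave:
  "convolution (plane_wave lam) g x = plane_wave lam x * (LINT y|lebesgue. g y * cnj (plane_wave lam y))"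
proof -
  have "(\<lambda>y. plane_wave lam (x - y) * g y) = (\<lambda>y. plane_wave lam x * (g y * cnj (plane_wave lam y)))"
    by (simp add: plane_wave_diff mult_ac)
  thus ?thesis unfolding convolution_def by simp
qed

text \<open>The two half-line indicators add up to 1 except at 0, where both vanish; this is why z =
  0 is excluded.\<close>

lemma G_plus_conv_G_minus:
  "z \<noteq> 0 \<Longrightarrow> G_minus lam z - (- \<i>) * plane_wave lam z = G_plus lam z"
  by (auto simp: G_plus_def G_minus_def indicator_def)

lemma mild_kernel_G_plus:
  assumes "lam > 0"
  shows "mild_kernel (G_plus lam)"
  by (rule mild_kernel_cong[OF mild_kernel_diff[OF mild_kernel_G_minus[OF assms]
        mild_kernel_cmult[OF mild_kernel_plane_wave]] G_plus_conv_G_minus])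

text \<open>The two operators differ by one of rank one with range spanned by the plane
  wave.\<close>

lemma convolution_G_plus:
  assumes "lam > 0" "dominated g B"
  shows "convolution (G_plus lam) g x = convolution (G_minus lam) g x
    + \<i> * plane_wave lam x * (LINT y|lebesgue. g y * cnj (plane_wave lam y))"
proof -
  have "g \<in> borel_measurable lebesgue" using assms(2) by (simp add: dominated_def)
  hence "convolution (G_plus lam) g x = convolution (\<lambda>z. G_minus lam z - (- \<i>) * plane_wave lam z) g x"
    by (intro convolution_cong_kernel mild_kernel_G_plus assms(1) G_plus_conv_G_minus[symmetric])
  also have "\<dots> = convolution (G_minus lam) g x - (- \<i>) * convolution (plane_wave lam) g x"
    by (simp only: convolution_diff_kernel[OF mild_kernel_G_minus[OF assms(1)]
        mild_kernel_cmult[OF mild_kernel_plane_wave] assms(2)] convolution_cmult_kernel)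
  finally show ?thesis by (simp add: convolution_plane_wave)
qed

lemma plane_wave_not_AE_zero: "\<not> (AE x in lebesgue. plane_wave lam x = 0)"
  using AE_zero_continuous_imp_zero[OF continuous_on_plane_wave, of lam 0] by auto

text \<open>Reading the rank-one term as part of the inhomogeneity gives \<open>mp\<close> =
  \<Gamma> \<open>mm\<close> and, from the other side, \<open>mm\<close> = d \<open>mp\<close>. Were
  \<Gamma> d different from 1, \<open>mp\<close> would vanish almost everywhere and its equation
  would annihilate the plane wave. So d \<noteq> 0 is a consequence.\<close>

lemma jost_relation_me:
  assumes lam: "lam > 0"
    and plus: "unique_solution r u (G_plus lam) (plane_wave lam) mp"
    and minus: "unique_solution r u (G_minus lam) (plane_wave lam) mm"
  defines "\<Gamma> \<equiv> 1 + \<i> * (LINT x|lebesgue. complex_of_real (u x) * mp x * cnj (plane_wave lam x))"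
    and "d \<equiv> 1 - \<i> * (LINT x|lebesgue. complex_of_real (u x) * mm x * cnj (plane_wave lam x))"
  shows "AE x in lebesgue. mp x = \<Gamma> * mm x" "\<Gamma> * d = 1"
proof -
  have mp: "mp \<in> Linf_weighted r"
    "AE x in lebesgue. mp x = plane_wave lam x + convolution (G_plus lam) (\<lambda>y. complex_of_real (u y) * mp y) x"
    using plus by (auto simp: unique_solution_def solves_def)
  have mm: "mm \<in> Linf_weighted r"
    "AE x in lebesgue. mm x = plane_wave lam x + convolution (G_minus lam) (\<lambda>y. complex_of_real (u y) * mm y) x"
    using minus by (auto simp: unique_solution_def solves_def)
  obtain B C where dom: "dominated (\<lambda>y. complex_of_real (u y) * mp y) B"
    "dominated (\<lambda>y. complex_of_real (u y) * mm y) C"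
    using dominated_potential mp(1) mm(1) by metis
  have "AE x in lebesgue. mp x = \<Gamma> * plane_wave lam x + convolution (G_minus lam) (\<lambda>y. complex_of_real (u y) * mp y) x"
    using mp(2) unfolding convolution_G_plus[OF lam dom(1)] \<Gamma>_def
    by eventually_elim (simp add: algebra_simps)
  thus 1: "AE x in lebesgue. mp x = \<Gamma> * mm x"
    by (rule unique_solution_scaled[OF mild_kernel_G_minus[OF lam] minus mp(1)])
  have "AE x in lebesgue. mm x = d * plane_wave lam x + convolution (G_plus lam) (\<lambda>y. complex_of_real (u y) * mm y) x"
    using mm(2) unfolding convolution_G_plus[OF lam dom(2)] d_def
    by eventually_elim (simp add: algebra_simps)
  hence 2: "AE x in lebesgue. mm x = d * mp x"
    by (rule unique_solution_scaled[OF mild_kernel_G_plus[OF lam] plus mm(1)])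
  show "\<Gamma> * d = 1"
  proof (rule ccontr)
    assume ne: "\<Gamma> * d \<noteq> 1"
    from 1 2 have zero: "AE x in lebesgue. mp x = 0"
    proof eventually_elim
      case (elim x)
      hence "(1 - \<Gamma> * d) * mp x = 0" by (simp add: algebra_simps)
      thus ?case using ne by simp
    qed
    hence "AE x in lebesgue. complex_of_real (u x) * mp x = 0" by eventually_elim simp
    moreover have [measurable]: "mp \<in> borel_measurable lebesgue" using mp(1) by (rule Linf_weighted_measurable)
    ultimately have "convolution (G_plus lam) (\<lambda>y. complex_of_real (u y) * mp y) x = convolution (G_plus lam) (\<lambda>y. 0) x" for x
      by (intro convolution_cong_AE mild_kernel_G_plus lam) measurable
    hence "convolution (G_plus lam) (\<lambda>y. complex_of_real (u y) * mp y) x = 0" for x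
      by (simp add: convolution_def)
    with mp(2) zero have "AE x in lebesgue. plane_wave lam x = 0" by auto
    thus False using plane_wave_not_AE_zero by blast
  qed
qed

text \<open>In the difference of the two equations the constants 1 cancel, and the rank-one term is
  left as inhomogeneity, a multiple of the plane wave.\<close>

lemma jost_relation_m1:
  assumes lam: "lam > 0"
    and plus: "unique_solution r u (G_plus lam) (\<lambda>x. 1) mp"
    and minus: "unique_solution r u (G_minus lam) (\<lambda>x. 1) mm"
    and e_minus: "unique_solution r u (G_minus lam) (plane_wave lam) me"
  shows "AE x in lebesgue. mp x - mm x =
    \<i> * (LINT x|lebesgue. complex_of_real (u x) * mp x * cnj (plane_wave lam x)) * me x"
proof -
  have mp: "mp \<in> Linf_weighted r"
    "AE x in lebesgue. mp x = 1 + convolution (G_plus lam) (\<lambda>y. complex_of_real (u y) * mp y) x"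
    using plus by (auto simp: unique_solution_def solves_def)
  have mm: "mm \<in> Linf_weighted r"
    "AE x in lebesgue. mm x = 1 + convolution (G_minus lam) (\<lambda>y. complex_of_real (u y) * mm y) x"
    using minus by (auto simp: unique_solution_def solves_def)
  obtain B C where dom: "dominated (\<lambda>y. complex_of_real (u y) * mp y) B"
    "dominated (\<lambda>y. complex_of_real (u y) * mm y) C"
    using dominated_potential mp(1) mm(1) by metis
  define k where "k x = mp x + (-1) * mm x" for x
  have k: "k \<in> Linf_weighted r"
    unfolding k_def by (intro Linf_weighted_add mp(1) Linf_weighted_mult[OF mm(1), of _ 1]) auto
  have conv: "convolution (G_minus lam) (\<lambda>y. complex_of_real (u y) * k y) x =
      convolution (G_minus lam) (\<lambda>y. complex_of_real (u y) * mp y) x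
      + (-1) * convolution (G_minus lam) (\<lambda>y. complex_of_real (u y) * mm y) x" for x
  proof -
    have "(\<lambda>y. complex_of_real (u y) * k y) =
        (\<lambda>y. complex_of_real (u y) * mp y + (-1) * (complex_of_real (u y) * mm y))"
      by (simp add: k_def algebra_simps)
    thus ?thesis
      using convolution_add[OF mild_kernel_G_minus[OF lam] dom(1) dominated_cmult[OF dom(2), of "-1"], of x]
      unfolding convolution_cmult by simp
  qed
  from mp(2) mm(2) have "AE x in lebesgue. k x =
      \<i> * (LINT x|lebesgue. complex_of_real (u x) * mp x * cnj (plane_wave lam x)) * plane_wave lam x
      + convolution (G_minus lam) (\<lambda>y. complex_of_real (u y) * k y) x"
    unfolding conv convolution_G_plus[OF lam dom(1)]
    by eventually_elim (simp add: k_def algebra_simps)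
  from unique_solution_scaled[OF mild_kernel_G_minus[OF lam] e_minus k this]
  show ?thesis by (simp add: k_def)
qed

section \<open>Continuous representatives and the derivative in the spectral parameter\<close>

lemma reduced_representation:
  assumes lam: "lam > 0" and sol: "solves r u (G_minus lam) g m"
    and g: "continuous_on UNIV g" "\<And>x. norm (g x) \<le> b"
  shows "\<exists>p. (\<forall>x. apply_bcontfun p x = complex_of_real (weight x powr r) * (cnj (plane_wave lam x) * g x)
       + apply_bcontfun (weighted_convolution (reduced_kernel lam) p) x) \<and>
     (AE x in lebesgue. cnj (plane_wave lam x) * m x = complex_of_real (weight x powr (s - s1)) * apply_bcontfun p x)"
proof -
  let ?K = "reduced_kernel lam"
  note K = mild_kernel_reduced_kernel[OF lam]
  have m: "m \<in> Linf_weighted r"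
    "AE x in lebesgue. m x = g x + convolution (G_minus lam) (\<lambda>y. complex_of_real (u y) * m y) x"
    using sol by (auto simp: solves_def)
  define h where "h y = complex_of_real (u y) * (cnj (plane_wave lam y) * m y)" for y
  have "(\<lambda>y. cnj (plane_wave lam y) * m y) \<in> Linf_weighted r"
    by (rule Linf_weighted_mult[OF m(1), of _ 1]) auto
  then obtain B where dom: "dominated h B" using dominated_potential unfolding h_def by blast
  \<comment> \<open>The plane wave at x - y factors: the part in y is absorbed by \<open>h\<close>,
    the part in x comes out of the integral.\<close>
  have conv: "convolution ?K h x = cnj (plane_wave lam x) * convolution (G_minus lam) (\<lambda>y. complex_of_real (u y) * m y) x" for x
  proof -
    have "?K (x - y) * h y = cnj (plane_wave lam x) * (G_minus lam (x - y) * (complex_of_real (u y) * m y))" for y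
    proof -
      have "?K (x - y) * h y = (plane_wave lam y * cnj (plane_wave lam y)) *
          (cnj (plane_wave lam x) * (G_minus lam (x - y) * (complex_of_real (u y) * m y)))"
        unfolding reduced_kernel_def h_def plane_wave_diff complex_cnj_mult complex_cnj_cnj by (simp only: mult_ac)
      thus ?thesis by simp
    qed
    thus ?thesis unfolding convolution_def by simp
  qed
  \<comment> \<open>\<open>m\<close> is only a class modulo null sets, but the right side of its
    equation is a continuous function. Building \<open>p\<close> from it gives an equation valid at
    every point.\<close>
  define a where "a x = cnj (plane_wave lam x) * g x + convolution ?K h x" for x
  define p where "p = Bcontfun (\<lambda>x. complex_of_real (weight x powr r) * a x)"
  obtain b' where b': "\<And>x. norm (convolution ?K h x) \<le> b'"
    using convolution_continuous_bounded(2)[OF K dom] by blast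
  have "(\<lambda>x. complex_of_real (weight x powr r) * a x) \<in> bcontfun"
  proof (rule weighted_bcontfunI)
    show "continuous_on UNIV a"
      unfolding a_def by (intro continuous_on_add continuous_on_mult continuous_on_cnj continuous_on_plane_wave g
          convolution_continuous_bounded(1)[OF K dom])
    show "norm (a x) \<le> b + b'" for x
      unfolding a_def using g(2)[of x] b'[of x] by (intro norm_triangle_le) (simp add: norm_mult)
  qed
  hence p: "apply_bcontfun p x = complex_of_real (weight x powr r) * a x" for x
    unfolding p_def by (simp add: Bcontfun_inverse)
  from m(2) have n: "AE x in lebesgue. cnj (plane_wave lam x) * m x = complex_of_real (weight x powr (s - s1)) * apply_bcontfun p x"
  proof eventually_elim
    case (elim x)
    show ?case unfolding p weight_cancel by (subst elim) (simp add: a_def conv distrib_left)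
  qed
  hence "AE y in lebesgue. v y * apply_bcontfun p y = h y"
    by eventually_elim (simp add: h_def v_def)
  hence "convolution ?K (\<lambda>y. v y * apply_bcontfun p y) x = convolution ?K h x" for x
    using dominated_bcontfun[of p] dom by (intro convolution_cong_AE K) (auto simp: dominated_def)
  hence "apply_bcontfun p x = complex_of_real (weight x powr r) * (cnj (plane_wave lam x) * g x)
       + apply_bcontfun (weighted_convolution ?K p) x" for x
    unfolding p apply_weighted_convolution[OF K] by (simp add: a_def distrib_left)
  with n show ?thesis by blast
qed

text \<open>Undoing weight and conjugation turns a fixed point into a homogeneous solution in the
  weighted space; a unique solution for any one \<open>g\<close> forces that to vanish.\<close>

lemma weighted_convolution_injective:
  assumes lam: "lam > 0" and uniq: "unique_solution r u (G_minus lam) g m"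
    and p: "weighted_convolution (reduced_kernel lam) p = p"
  shows "p = 0"
proof -
  let ?K = "reduced_kernel lam"
  note K = mild_kernel_reduced_kernel[OF lam]
  have [measurable]: "apply_bcontfun p \<in> borel_measurable lebesgue" by (rule bcontfun_measurable_lebesgue)
  define n where "n x = plane_wave lam x * (complex_of_real (weight x powr (s - s1)) * apply_bcontfun p x)" for x
  have n_Linf: "n \<in> Linf_weighted r"
  proof (rule Linf_weightedI)
    show "n \<in> borel_measurable lebesgue" unfolding n_def by measurable
    show "AE x in lebesgue. weight x powr r * norm (n x) \<le> norm p"
      by (rule AE_I2) (simp add: n_def norm_mult mult.assoc[symmetric] norm_bounded del: minus_diff_eq)
  qed
  have n_eq: "n x = 0 * g x + convolution (G_minus lam) (\<lambda>y. complex_of_real (u y) * n y) x" for x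
  proof -
    have "G_minus lam (x - y) * (complex_of_real (u y) * n y) = plane_wave lam x * (?K (x - y) * (v y * apply_bcontfun p y))" for y
    proof -
      have "plane_wave lam x * (?K (x - y) * (v y * apply_bcontfun p y)) =
        (plane_wave lam x * cnj (plane_wave lam x)) * (G_minus lam (x - y) * (complex_of_real (u y) * n y))"
        unfolding reduced_kernel_def n_def v_def plane_wave_diff complex_cnj_mult complex_cnj_cnj of_real_mult
        by (simp only: mult_ac)
      thus ?thesis by simp
    qed
    hence "convolution (G_minus lam) (\<lambda>y. complex_of_real (u y) * n y) x = plane_wave lam x * convolution ?K (\<lambda>y. v y * apply_bcontfun p y) x"
      unfolding convolution_def by simp
    moreover have "n x = plane_wave lam x * convolution ?K (\<lambda>y. v y * apply_bcontfun p y) x"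
      unfolding n_def by (subst p[symmetric], subst apply_weighted_convolution[OF K]) (simp only: weight_cancel)
    ultimately show ?thesis by simp
  qed
  have "AE x in lebesgue. n x = 0 * m x"
    by (rule unique_solution_scaled[OF mild_kernel_G_minus[OF lam] uniq n_Linf AE_I2[OF n_eq]])
  hence "AE x in lebesgue. apply_bcontfun p x = 0"
    by eventually_elim (simp add: n_def)
  hence "apply_bcontfun p x = 0" for x
    by (intro AE_zero_continuous_imp_zero[of "apply_bcontfun p"]) auto
  thus ?thesis by (intro bcontfun_eqI) simp
qed

text \<open>The derivative kernel is an exponential in x - y, so the convolution separates. Its
  factor in y undoes the conjugation of m_e and leaves the integral of u m_e that defines
  \<open>jost_f\<close>.\<close>

lemma reduced_kernel_deriv_convolution:
  assumes "AE y in lebesgue. cnj (plane_wave lam y) * me lam y = complex_of_real (weight y powr (s - s1)) * apply_bcontfun p y"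
    and [measurable]: "me lam \<in> borel_measurable lebesgue"
  shows "convolution (reduced_kernel_deriv lam) (\<lambda>y. v y * apply_bcontfun p y) x
    = cnj (plane_wave lam x) * jost_f u me lam"
proof -
  have [measurable]: "apply_bcontfun p \<in> borel_measurable lebesgue" by (rule bcontfun_measurable_lebesgue)
  let ?c = "- 1 / (2 * complex_of_real pi * complex_of_real lam)"
  have int: "(LINT y|lebesgue. plane_wave lam y * (v y * apply_bcontfun p y)) = (LINT y|lebesgue. complex_of_real (u y) * me lam y)"
  proof (rule integral_cong_AE)
    show "AE y in lebesgue. plane_wave lam y * (v y * apply_bcontfun p y) = complex_of_real (u y) * me lam y"
      using assms(1)
    proof eventually_elim
      case (elim y)
      have "plane_wave lam y * (v y * apply_bcontfun p y) = complex_of_real (u y) * plane_wave lam y *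
          (complex_of_real (weight y powr (s - s1)) * apply_bcontfun p y)"
        by (simp add: v_def)
      also have "\<dots> = complex_of_real (u y) * (plane_wave lam y * cnj (plane_wave lam y)) * me lam y"
        unfolding elim[symmetric] by (simp only: mult_ac)
      finally show ?case by simp
    qed
  qed measurable
  have "reduced_kernel_deriv lam (x - y) * (v y * apply_bcontfun p y) =
      (?c * cnj (plane_wave lam x)) * (plane_wave lam y * (v y * apply_bcontfun p y))" for y
    by (simp add: reduced_kernel_deriv_def plane_wave_diff)
  hence "convolution (reduced_kernel_deriv lam) (\<lambda>y. v y * apply_bcontfun p y) x =
      (?c * cnj (plane_wave lam x)) * (LINT y|lebesgue. plane_wave lam y * (v y * apply_bcontfun p y))"
    unfolding convolution_def by simp
  thus ?thesis unfolding int by (simp add: jost_f_def)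
qed

text \<open>By \<open>N\<close> the product v p is u times a bounded function, so one power s - s1
  of the weight is free. It pays for \<open>weight y powr \<theta>\<close>, and the output weight
  pays for \<open>weight x powr \<theta>\<close>.\<close>

lemma difference_quotient_kernel_bound:
  assumes lam: "lam > 0" and h: "\<bar>h\<bar> \<le> lam / 2" "h \<noteq> 0"
    and \<theta>: "0 < \<theta>" "\<theta> \<le> 1" "\<theta> \<le> s - s1"
    and N: "\<And>x. norm (complex_of_real (weight x powr (s - s1)) * apply_bcontfun p x) \<le> N"
  shows "norm (weighted_convolution (\<lambda>z. complex_of_real (1 / h) *
      (reduced_kernel (lam + h) z - reduced_kernel lam z) - reduced_kernel_deriv lam z) p)
    \<le> (4 / lam) powr (1 - \<theta>) * (2 / lam + 2 / lam\<^sup>2) powr \<theta> * N * (LINT y|lebesgue. norm (v y)) * \<bar>h\<bar> powr \<theta>"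
proof (rule norm_bound)
  fix x
  define R where "R z = complex_of_real (1 / h) * (reduced_kernel (lam + h) z - reduced_kernel lam z)
      - reduced_kernel_deriv lam z" for z
  define A where "A = (4 / lam) powr (1 - \<theta>) * (2 / lam + 2 / lam\<^sup>2) powr \<theta> * \<bar>h\<bar> powr \<theta>"
  have "N \<ge> 0" using N[of 0] norm_ge_zero order_trans by blast
  have "A \<ge> 0" by (simp add: A_def)
  have "lam + h > 0" using h lam by linarith
  have mild: "mild_kernel R"
    unfolding R_def by (intro mild_kernel_diff mild_kernel_cmult mild_kernel_reduced_kernel
        mild_kernel_reduced_kernel_deriv lam \<open>lam + h > 0\<close>)
  have R: "norm (R z) \<le> A * weight z powr \<theta>" if "z \<noteq> 0" for z
    using reduced_kernel_difference_quotient[OF lam h that \<theta>(1,2)] by (simp add: R_def A_def mult_ac)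
  have "norm (convolution R (\<lambda>y. v y * apply_bcontfun p y) x) \<le>
      (LINT y|lebesgue. norm (R (x - y) * (v y * apply_bcontfun p y)))"
    unfolding convolution_def by (rule integral_norm_bound)
  also have "\<dots> \<le> (LINT y|lebesgue. A * weight x powr \<theta> * N * norm (v y))"
  proof (intro integral_mono_AE integrable_norm integrable_kernel_dominated[OF mild dominated_bcontfun]
      integrable_mult_right v_integrable)
    show "AE y in lebesgue. norm (R (x - y) * (v y * apply_bcontfun p y)) \<le> A * weight x powr \<theta> * N * norm (v y)"
      using AE_lebesgue_neq[of x]
    proof eventually_elim
      case (elim y)
      have "norm (R (x - y)) \<le> A * weight (x - y) powr \<theta>" using elim by (intro R) simp
      also have "\<dots> \<le> A * (weight x * weight y) powr \<theta>"
        using \<open>A \<ge> 0\<close> \<theta>(1) by (intro mult_left_mono powr_mono2 weight_diff_le) (auto intro: less_imp_le)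
      finally have 1: "norm (R (x - y)) \<le> A * weight x powr \<theta> * weight y powr \<theta>"
        by (simp add: powr_mult mult.assoc)
      have "norm (v y * apply_bcontfun p y) = \<bar>u y\<bar> * norm (complex_of_real (weight y powr (s - s1)) * apply_bcontfun p y)"
        by (simp add: norm_mult norm_v)
      hence 2: "norm (v y * apply_bcontfun p y) \<le> \<bar>u y\<bar> * N"
        using mult_left_mono[OF N[of y], of "\<bar>u y\<bar>"] by simp
      have "\<bar>u y\<bar> * weight y powr \<theta> \<le> norm (v y)"
        unfolding norm_v using \<theta>(3) weight_ge_1[of y] by (intro mult_left_mono powr_mono) auto
      hence "A * weight x powr \<theta> * N * (\<bar>u y\<bar> * weight y powr \<theta>) \<le> A * weight x powr \<theta> * N * norm (v y)"
        using \<open>A \<ge> 0\<close> \<open>N \<ge> 0\<close> by (intro mult_left_mono) auto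
      moreover have "norm (R (x - y) * (v y * apply_bcontfun p y)) \<le>
          (A * weight x powr \<theta> * weight y powr \<theta>) * (\<bar>u y\<bar> * N)"
        unfolding norm_mult[of "R (x - y)"] using \<open>A \<ge> 0\<close> by (intro mult_mono 1 2) auto
      ultimately show ?case by (simp add: mult_ac)
    qed
  qed
  also have "\<dots> = A * weight x powr \<theta> * N * (LINT y|lebesgue. norm (v y))" by simp
  finally have conv: "norm (convolution R (\<lambda>y. v y * apply_bcontfun p y) x) \<le>
      A * weight x powr \<theta> * N * (LINT y|lebesgue. norm (v y))" .
  have "norm (apply_bcontfun (weighted_convolution R p) x) =
      weight x powr r * norm (convolution R (\<lambda>y. v y * apply_bcontfun p y) x)"
    unfolding apply_weighted_convolution[OF mild] norm_mult by simp
  also have "\<dots> \<le> weight x powr r * (A * weight x powr \<theta> * N * (LINT y|lebesgue. norm (v y)))"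
    by (intro mult_left_mono conv) simp
  also have "\<dots> = weight x powr (r + \<theta>) * (A * N * (LINT y|lebesgue. norm (v y)))"
    unfolding powr_add by (simp only: mult_ac)
  \<comment> \<open>By \<theta> \<le> s - s1 the exponent is not positive, so the remaining weight
    is at most 1 uniformly in x.\<close>
  also have "\<dots> \<le> weight x powr 0 * (A * N * (LINT y|lebesgue. norm (v y)))"
    using \<open>A \<ge> 0\<close> \<open>N \<ge> 0\<close> \<theta>(3) weight_ge_1[of x] by (intro mult_right_mono powr_mono mult_nonneg_nonneg) auto
  also have "\<dots> = (4 / lam) powr (1 - \<theta>) * (2 / lam + 2 / lam\<^sup>2) powr \<theta> * N * (LINT y|lebesgue. norm (v y)) * \<bar>h\<bar> powr \<theta>"
    by (simp add: A_def)
  finally show "norm (apply_bcontfun (weighted_convolution (\<lambda>z. complex_of_real (1 / h) *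
      (reduced_kernel (lam + h) z - reduced_kernel lam z) - reduced_kernel_deriv lam z) p) x) \<le> \<dots>"
    unfolding R_def .
qed

text \<open>With T the operator at \<open>lam\<close>, the error \<rho> of the difference quotient
  of the representatives is estimated through (1 - T) \<rho>, which consists of kernel errors
  only.\<close>

lemma jost_derivative:
  assumes lam: "lam > 0"
    and me: "\<And>l. l > 0 \<Longrightarrow> unique_solution r u (G_minus l) (plane_wave l) (me l)"
    and m1: "unique_solution r u (G_minus lam) (\<lambda>x. 1) m1"
  shows "has_Linf_derivative r (\<lambda>l x. cnj (plane_wave l x) * me l x)
    (\<lambda>x. cnj (plane_wave lam x) * (jost_f u me lam * m1 x)) lam"
proof -
  define T where "T l = weighted_convolution (reduced_kernel l)" for l
  define f where "f = jost_f u me lam"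
  have me_Linf: "me l \<in> Linf_weighted r" if "l > 0" for l
    using me[OF that] by (simp add: unique_solution_def solves_def)
  have m1_Linf: "m1 \<in> Linf_weighted r"
    and m1_eq: "AE x in lebesgue. m1 x = 1 + convolution (G_minus lam) (\<lambda>y. complex_of_real (u y) * m1 y) x"
    using m1 by (auto simp: unique_solution_def solves_def)
  \<comment> \<open>The wave and its conjugate cancel in the inhomogeneity, which becomes
    \<open>weight x powr r\<close> for every \<open>l\<close>; this is why the conjugated solutions
    are compared.\<close>
  define represents where "represents l p \<longleftrightarrow>
     (\<forall>x. apply_bcontfun p x = complex_of_real (weight x powr r) + apply_bcontfun (T l p) x) \<and>
     (AE x in lebesgue. cnj (plane_wave l x) * me l x = complex_of_real (weight x powr (s - s1)) * apply_bcontfun p x)" for l p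
  have ex: "\<exists>p. represents l p" if "l > 0" for l
  proof -
    have "solves r u (G_minus l) (plane_wave l) (me l)"
      using me[OF that] by (simp add: unique_solution_def)
    from reduced_representation[OF that this continuous_on_plane_wave, of 1]
    show ?thesis
      by (simp only: represents_def norm_plane_wave cnj_plane_wave_mult mult_1_right T_def order_refl simp_thms)
  qed
  define P where "P l = (SOME p. represents l p)" for l
  have "represents l (P l)" if "l > 0" for l
    unfolding P_def using ex[OF that] by (rule someI_ex)
  hence P: "\<And>l x. l > 0 \<Longrightarrow> apply_bcontfun (P l) x = complex_of_real (weight x powr r) + apply_bcontfun (T l (P l)) x"
    "\<And>l. l > 0 \<Longrightarrow> AE x in lebesgue. cnj (plane_wave l x) * me l x = complex_of_real (weight x powr (s - s1)) * apply_bcontfun (P l) x"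
    unfolding represents_def by blast+
  have fm1_Linf: "(\<lambda>x. f * m1 x) \<in> Linf_weighted r"
    by (rule Linf_weighted_mult[OF m1_Linf, of _ "norm f"]) auto
  \<comment> \<open>A constant inhomogeneity f turns, after conjugation, into f times the conjugate
    wave, which is what the derivative of the kernel produces from m_e. So \<open>q\<close> is the
    candidate derivative.\<close>
  have "solves r u (G_minus lam) (\<lambda>x. f) (\<lambda>x. f * m1 x)"
  proof -
    have "convolution (G_minus lam) (\<lambda>y. complex_of_real (u y) * (f * m1 y)) x =
        f * convolution (G_minus lam) (\<lambda>y. complex_of_real (u y) * m1 y) x" for x
      using convolution_cmult[of "G_minus lam" f "\<lambda>y. complex_of_real (u y) * m1 y" x] by (simp only: mult.left_commute)
    with fm1_Linf show ?thesis
      unfolding solves_def using m1_eq by (simp add: distrib_left eventually_mono)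
  qed
  from reduced_representation[OF lam this continuous_on_const order_refl] obtain q where
    q: "\<And>x. apply_bcontfun q x = complex_of_real (weight x powr r) * (cnj (plane_wave lam x) * f) + apply_bcontfun (T lam q) x"
    and q_AE: "AE x in lebesgue. cnj (plane_wave lam x) * (f * m1 x) = complex_of_real (weight x powr (s - s1)) * apply_bcontfun q x"
    unfolding T_def by blast
  have mild: "mild_kernel (reduced_kernel l)" if "l > 0" for l
    by (rule mild_kernel_reduced_kernel[OF that])
  interpret T: bounded_linear "T lam"
    unfolding T_def by (rule bounded_linear_weighted_convolution[OF mild[OF lam]])
  obtain c where c: "c > 0" "\<And>p. norm p \<le> c * norm (p - T lam p)"
    using weighted_convolution_bounded_below[OF mild[OF lam] weighted_convolution_injective[OF lam me[OF lam]]]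
    unfolding T_def by blast
  obtain b where b: "\<And>x. norm (convolution (reduced_kernel lam) (\<lambda>y. v y * apply_bcontfun (P lam) y) x) \<le> b"
    using convolution_continuous_bounded(2)[OF mild[OF lam] dominated_bcontfun] by blast
  \<comment> \<open>Boundedness of m_e at \<open>lam\<close>, read off its equation: the wave and
    the convolution are both bounded without weight.\<close>
  have N: "norm (complex_of_real (weight x powr (s - s1)) * apply_bcontfun (P lam) x) \<le> 1 + b" for x
  proof -
    have "apply_bcontfun (P lam) x =
        complex_of_real (weight x powr r) * (1 + convolution (reduced_kernel lam) (\<lambda>y. v y * apply_bcontfun (P lam) y) x)"
      by (subst P(1)[OF lam]) (simp only: T_def apply_weighted_convolution[OF mild[OF lam]] distrib_left mult_1_right)
    hence eq: "complex_of_real (weight x powr (s - s1)) * apply_bcontfun (P lam) x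
       = 1 + convolution (reduced_kernel lam) (\<lambda>y. v y * apply_bcontfun (P lam) y) x"
      by (simp only: weight_cancel)
    show ?thesis unfolding eq using b[of x] by (intro norm_triangle_le) simp
  qed
  \<comment> \<open>At most 1 for the interpolation and at most s - s1 for the weights.\<close>
  define \<theta> where "\<theta> = min 1 (s - s1)"
  have \<theta>: "0 < \<theta>" "\<theta> \<le> 1" "\<theta> \<le> s - s1" using s_gt by (auto simp: \<theta>_def)
  define M where "M = 2 / lam * majorant_mass"
  have "M \<ge> 0" using lam majorant_mass_nonneg by (simp add: M_def)
  define A where "A = (4 / lam) powr (1 - \<theta>) * (2 / lam + 2 / lam\<^sup>2) powr \<theta> * (1 + b) * (LINT y|lebesgue. norm (v y))"
  define E where "E h z = reduced_kernel (lam + h) z - reduced_kernel lam z" for h z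
  define \<rho> where "\<rho> h = (P (lam + h) - P lam) /\<^sub>R h - q" for h
  define bound where "bound h = c * (M * (2 * c * M * \<bar>h\<bar> * norm (P lam)) + A * \<bar>h\<bar> powr \<theta>)" for h
  \<comment> \<open>The first entry keeps lam + h above lam / 2. The second gives c M |h| \<le> 1/2
    for the absorption, and its \<open>+ 1\<close> keeps the denominator positive when M =
    0.\<close>
  define h0 where "h0 = min (lam / 2) (1 / (2 * c * M + 1))"
  have "h0 > 0" using lam c(1) \<open>M \<ge> 0\<close> by (simp add: h0_def add_nonneg_pos)
  have \<rho>_le: "norm (\<rho> h) \<le> bound h" if h: "\<bar>h\<bar> < h0" "h \<noteq> 0" for h
  proof -
    have h2: "\<bar>h\<bar> \<le> lam / 2" using h by (simp add: h0_def)
    hence t: "lam + h > 0" using lam by linarith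
    have E_mild: "mild_kernel (E h)" unfolding E_def by (intro mild_kernel_diff mild t lam)
    have E_norm: "norm (weighted_convolution (E h) p) \<le> M * \<bar>h\<bar> * norm p" for p
    proof -
      have "norm (weighted_convolution (E h) p) \<le> 2 / lam * \<bar>h\<bar> * majorant_mass * norm p"
      proof (rule norm_weighted_convolution_le_bounded)
        show "continuous_on (- {0}) (E h)" using E_mild by (simp add: mild_kernel_def)
        show "norm (E h z) \<le> 2 / lam * \<bar>h\<bar>" if "z \<noteq> 0" for z
          unfolding E_def by (rule norm_reduced_kernel_diff_le[OF lam h2 that])
      qed (use lam in simp)
      thus ?thesis by (simp add: M_def mult_ac)
    qed
    have T_diff: "T (lam + h) p = T lam p + weighted_convolution (E h) p" for p
      using weighted_convolution_diff_kernel[OF mild[OF t] mild[OF lam], of p] by (simp add: T_def E_def[abs_def])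
    \<comment> \<open>The inhomogeneities agree and cancel, leaving the kernel increment applied to
      the solution at lam + h.\<close>
    have step: "(P (lam + h) - P lam) - T lam (P (lam + h) - P lam) = weighted_convolution (E h) (P (lam + h))"
    proof (rule bcontfun_eqI)
      fix x
      show "apply_bcontfun ((P (lam + h) - P lam) - T lam (P (lam + h) - P lam)) x =
          apply_bcontfun (weighted_convolution (E h) (P (lam + h))) x"
        using P(1)[OF t, of x] P(1)[OF lam, of x] by (simp add: T.diff T_diff)
    qed
    \<comment> \<open>No bound for \<open>P (lam + h)\<close> is known yet. Its norm is split into
      that of \<open>P lam\<close> and that of the increment, and the latter is absorbed.\<close>
    have "norm (P (lam + h) - P lam) \<le> c * (M * \<bar>h\<bar> * norm (P (lam + h)))"
      using c(2)[of "P (lam + h) - P lam"] mult_left_mono[OF E_norm[of "P (lam + h)"], of c] c(1)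
      unfolding step by linarith
    also have "\<dots> \<le> c * (M * \<bar>h\<bar> * (norm (P (lam + h) - P lam) + norm (P lam)))"
      using c(1) \<open>M \<ge> 0\<close> norm_triangle_sub[of "P (lam + h)" "P lam"]
      by (intro mult_left_mono) (auto simp: add.commute)
    also have "\<dots> = (c * M * \<bar>h\<bar>) * norm (P (lam + h) - P lam) + c * M * \<bar>h\<bar> * norm (P lam)"
      by (simp add: algebra_simps)
    also have "(c * M * \<bar>h\<bar>) * norm (P (lam + h) - P lam) \<le> 1/2 * norm (P (lam + h) - P lam)"
    proof (rule mult_right_mono)
      have "c * M * \<bar>h\<bar> \<le> c * M * (1 / (2 * c * M + 1))"
        using h c(1) \<open>M \<ge> 0\<close> by (intro mult_left_mono) (auto simp: h0_def)
      also have "\<dots> \<le> 1/2" using c(1) \<open>M \<ge> 0\<close> by (simp add: divide_le_eq add_nonneg_pos)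
      finally show "c * M * \<bar>h\<bar> \<le> 1/2" .
    qed simp
    finally have P_diff: "norm (P (lam + h) - P lam) \<le> 2 * c * M * \<bar>h\<bar> * norm (P lam)" by simp
    define Q where "Q z = complex_of_real (1 / h) * E h z" for z
    have Q_mild: "mild_kernel Q" unfolding Q_def by (intro mild_kernel_cmult E_mild)
    interpret Q: bounded_linear "weighted_convolution Q"
      by (rule bounded_linear_weighted_convolution[OF Q_mild])
    have Q: "weighted_convolution Q p = weighted_convolution (E h) p /\<^sub>R h" for p
      unfolding Q_def[abs_def] weighted_convolution_cmult_kernel[OF E_mild] by (simp add: divide_inverse)
    \<comment> \<open>The differentiated equation in weighted form.\<close>
    have q_T: "q - T lam q = weighted_convolution (reduced_kernel_deriv lam) (P lam)"
    proof (rule bcontfun_eqI)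
      fix x
      have "me lam \<in> borel_measurable lebesgue" using me_Linf[OF lam] by (rule Linf_weighted_measurable)
      thus "apply_bcontfun (q - T lam q) x = apply_bcontfun (weighted_convolution (reduced_kernel_deriv lam) (P lam)) x"
        using q[of x] by (simp add: apply_weighted_convolution[OF mild_kernel_reduced_kernel_deriv]
            reduced_kernel_deriv_convolution[where me=me, OF P(2)[OF lam]] f_def)
    qed
    have "\<rho> h - T lam (\<rho> h) = ((P (lam + h) - P lam) - T lam (P (lam + h) - P lam)) /\<^sub>R h - (q - T lam q)"
      unfolding \<rho>_def T.diff T.scaleR by (simp add: algebra_simps)
    also have "\<dots> = weighted_convolution Q (P (lam + h)) - weighted_convolution (reduced_kernel_deriv lam) (P lam)"
      unfolding step q_T Q ..
    \<comment> \<open>Two errors: the quotient kernel, bounded uniformly in h, acts on an increment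
      of order h; the kernel error acts on the fixed \<open>P lam\<close>, to which \<open>N\<close>
      applies.\<close>
    also have "\<dots> = weighted_convolution Q (P (lam + h) - P lam)
        + weighted_convolution (\<lambda>z. Q z - reduced_kernel_deriv lam z) (P lam)"
      by (simp add: Q.diff weighted_convolution_diff_kernel[OF Q_mild mild_kernel_reduced_kernel_deriv])
    finally have \<rho>_eq: "\<rho> h - T lam (\<rho> h) = \<dots>" .
    have "norm (weighted_convolution Q (P (lam + h) - P lam)) \<le> M * norm (P (lam + h) - P lam)"
      using E_norm[of "P (lam + h) - P lam"] h(2) by (simp add: Q field_simps)
    also have "\<dots> \<le> M * (2 * c * M * \<bar>h\<bar> * norm (P lam))"
      by (intro mult_left_mono P_diff \<open>M \<ge> 0\<close>)
    finally have 1: "norm (weighted_convolution Q (P (lam + h) - P lam)) \<le> M * (2 * c * M * \<bar>h\<bar> * norm (P lam))" .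
    have 2: "norm (weighted_convolution (\<lambda>z. Q z - reduced_kernel_deriv lam z) (P lam)) \<le> A * \<bar>h\<bar> powr \<theta>"
      unfolding Q_def E_def A_def by (rule difference_quotient_kernel_bound[OF lam h2 h(2) \<theta> N])
    have "norm (\<rho> h) \<le> c * norm (\<rho> h - T lam (\<rho> h))" by (rule c(2))
    also have "\<dots> \<le> bound h"
      unfolding \<rho>_eq bound_def using c(1) 1 2 by (intro mult_left_mono norm_triangle_le add_mono) auto
    finally show ?thesis .
  qed
  have bound_0: "(bound \<longlongrightarrow> 0) (at 0)"
  proof -
    have "((\<lambda>h::real. \<bar>h\<bar> powr \<theta>) \<longlongrightarrow> 0) (at 0)"
      using \<theta>(1) by (intro tendsto_zero_powrI[where b=\<theta>]) (auto intro!: tendsto_eq_intros)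
    moreover have "((\<lambda>h::real. \<bar>h\<bar>) \<longlongrightarrow> 0) (at 0)" by (auto intro!: tendsto_eq_intros)
    ultimately have "(bound \<longlongrightarrow> c * (M * (2 * c * M * 0 * norm (P lam)) + A * 0)) (at 0)"
      unfolding bound_def by (intro tendsto_intros)
    thus ?thesis by simp
  qed
  have F_Linf: "(\<lambda>x. cnj (plane_wave l x) * me l x) \<in> Linf_weighted r" if "l > 0" for l
    by (rule Linf_weighted_mult[OF me_Linf[OF that], of _ 1]) auto
  have D_Linf: "(\<lambda>x. cnj (plane_wave lam x) * (f * m1 x)) \<in> Linf_weighted r"
    by (rule Linf_weighted_mult[OF fm1_Linf, of _ 1]) auto
  have norm_le: "Linf_norm r (\<lambda>x. (cnj (plane_wave (lam + h) x) * me (lam + h) x - cnj (plane_wave lam x) * me lam x)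
      / complex_of_real h - cnj (plane_wave lam x) * (f * m1 x)) \<le> ennreal (bound h)"
    if h: "\<bar>h\<bar> < h0" "h \<noteq> 0" for h
  proof (rule Linf_norm_le)
    have "\<bar>h\<bar> < lam / 2" using h(1) by (simp add: h0_def)
    hence t: "lam + h > 0" using lam by linarith
    note [measurable] = me_Linf[OF t, THEN Linf_weighted_measurable] me_Linf[OF lam, THEN Linf_weighted_measurable]
      Linf_weighted_measurable[OF m1_Linf]
    show "(\<lambda>x. (cnj (plane_wave (lam + h) x) * me (lam + h) x - cnj (plane_wave lam x) * me lam x)
      / complex_of_real h - cnj (plane_wave lam x) * (f * m1 x)) \<in> borel_measurable lebesgue"
      by measurable
    show "AE x in lebesgue. weight x powr r * norm ((cnj (plane_wave (lam + h) x) * me (lam + h) x - cnj (plane_wave lam x) * me lam x)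
      / complex_of_real h - cnj (plane_wave lam x) * (f * m1 x)) \<le> bound h"
      using P(2)[OF t] P(2)[OF lam] q_AE
    proof eventually_elim
      case (elim x)
      have "(cnj (plane_wave (lam + h) x) * me (lam + h) x - cnj (plane_wave lam x) * me lam x)
          / complex_of_real h - cnj (plane_wave lam x) * (f * m1 x)
        = complex_of_real (weight x powr (s - s1)) * apply_bcontfun (\<rho> h) x"
        unfolding elim \<rho>_def by (simp add: scaleR_conv_of_real divide_inverse algebra_simps)
      \<comment> \<open>The weights s - s1 and r cancel, so the weighted norm is governed by the
        supremum norm of \<rho>.\<close>
      hence "weight x powr r * norm ((cnj (plane_wave (lam + h) x) * me (lam + h) x - cnj (plane_wave lam x) * me lam x)
          / complex_of_real h - cnj (plane_wave lam x) * (f * m1 x))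
        = (weight x powr (s - s1) * weight x powr r) * norm (apply_bcontfun (\<rho> h) x)"
        by (simp only: norm_mult norm_of_real abs_of_nonneg[OF powr_ge_zero] mult_ac)
      also have "\<dots> = norm (apply_bcontfun (\<rho> h) x)" by (simp only: weight_powr_minus_mult mult_1)
      also have "\<dots> \<le> bound h" using norm_bounded[of "\<rho> h" x] \<rho>_le[OF h] by linarith
      finally show ?case .
    qed
  qed
  have near: "\<forall>\<^sub>F h in at 0. \<bar>h\<bar> < h0 \<and> h \<noteq> 0"
    using \<open>h0 > 0\<close> by (auto simp: eventually_at dist_real_def)
  show ?thesis
    unfolding has_Linf_derivative_def f_def[symmetric]
  proof (intro conjI D_Linf)
    have "\<forall>\<^sub>F l in nhds lam. l > 0" using lam by (rule order_tendstoD[OF filterlim_ident])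
    thus "\<forall>\<^sub>F l in nhds lam. (\<lambda>x. cnj (plane_wave l x) * me l x) \<in> Linf_weighted r"
      by eventually_elim (rule F_Linf)
    show "((\<lambda>h. Linf_norm r (\<lambda>x. (cnj (plane_wave (lam + h) x) * me (lam + h) x - cnj (plane_wave lam x) * me lam x)
      / complex_of_real h - cnj (plane_wave lam x) * (f * m1 x))) \<longlongrightarrow> 0) (at 0)"
    proof (rule tendsto_sandwich[of "\<lambda>_. 0" _ _ "\<lambda>h. ennreal (bound h)"])
      show "((\<lambda>h. ennreal (bound h)) \<longlongrightarrow> 0) (at 0)"
        using tendsto_ennrealI[OF bound_0] by simp
      show "\<forall>\<^sub>F h in at 0. Linf_norm r (\<lambda>x. (cnj (plane_wave (lam + h) x) * me (lam + h) x - cnj (plane_wave lam x) * me lam x)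
      / complex_of_real h - cnj (plane_wave lam x) * (f * m1 x)) \<le> ennreal (bound h)"
        using near by eventually_elim (intro norm_le, auto)
    qed auto
  qed
qed

end

theorem lemma4p2:
  fixes s s1 :: real and u :: "real \<Rightarrow> real"
    and m1_plus m1_minus me_plus me_minus :: "real \<Rightarrow> real \<Rightarrow> complex"
  assumes "s > s1" and "s1 > 1/2"
    and "u \<in> L2_weighted s"
    and "\<And>lam. lam > 0 \<Longrightarrow> unique_solution (- (s - s1)) u (G_plus lam) (\<lambda>x. 1) (m1_plus lam)"
    and "\<And>lam. lam > 0 \<Longrightarrow> unique_solution (- (s - s1)) u (G_minus lam) (\<lambda>x. 1) (m1_minus lam)"
    and "\<And>lam. lam > 0 \<Longrightarrow> unique_solution (- (s - s1)) u (G_plus lam) (plane_wave lam) (me_plus lam)"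
    and "\<And>lam. lam > 0 \<Longrightarrow> unique_solution (- (s - s1)) u (G_minus lam) (plane_wave lam) (me_minus lam)"
  shows "\<forall>lam>0.
    (let d = 1 - \<i> * (LINT x|lebesgue.
               complex_of_real (u x) * me_minus lam x * cnj (plane_wave lam x))
     in d \<noteq> 0 \<and> jost_Gamma u me_plus lam = 1 / d) \<and>
    (AE x in lebesgue. me_plus lam x = jost_Gamma u me_plus lam * me_minus lam x) \<and>
    (AE x in lebesgue. m1_plus lam x - m1_minus lam x = jost_beta u m1_plus lam * me_minus lam x) \<and>
    (\<exists>D. has_Linf_derivative (- (s - s1)) (\<lambda>\<tau> x. cnj (plane_wave \<tau> x) * me_minus \<tau> x) D lam \<and>
         (AE x in lebesgue. plane_wave lam x * D x = jost_f u me_minus lam * m1_minus lam x))"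
proof (intro allI impI)
  fix lam :: real assume lam: "lam > 0"
  interpret jost_potential s s1 u by unfold_locales (use assms(1-3) in auto)
  note me = jost_relation_me[OF lam assms(6)[OF lam] assms(7)[OF lam], folded jost_Gamma_def]
  let ?d = "1 - \<i> * (LINT x|lebesgue. complex_of_real (u x) * me_minus lam x * cnj (plane_wave lam x))"
  have "?d \<noteq> 0" using me(2) by auto
  moreover from this have "jost_Gamma u me_plus lam = 1 / ?d" using me(2) by (simp add: eq_divide_eq)
  moreover have "AE x in lebesgue. m1_plus lam x - m1_minus lam x = jost_beta u m1_plus lam * me_minus lam x"
    unfolding jost_beta_def
    by (rule jost_relation_m1[OF lam assms(4)[OF lam] assms(5)[OF lam] assms(7)[OF lam]])
  \<comment> \<open>The derivative is taken to be the conjugate wave times f m_1; multiplication by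
    the wave removes the conjugate.\<close>
  moreover have "AE x in lebesgue. plane_wave lam x * (cnj (plane_wave lam x) * (jost_f u me_minus lam * m1_minus lam x))
      = jost_f u me_minus lam * m1_minus lam x"
    by (rule AE_I2) (simp flip: mult.assoc)
  moreover have "has_Linf_derivative (- (s - s1)) (\<lambda>\<tau> x. cnj (plane_wave \<tau> x) * me_minus \<tau> x)
      (\<lambda>x. cnj (plane_wave lam x) * (jost_f u me_minus lam * m1_minus lam x)) lam"
    by (rule jost_derivative[OF lam assms(7) assms(5)[OF lam]])
  ultimately show "(let d = ?d in d \<noteq> 0 \<and> jost_Gamma u me_plus lam = 1 / d) \<and>
    (AE x in lebesgue. me_plus lam x = jost_Gamma u me_plus lam * me_minus lam x) \<and>
    (AE x in lebesgue. m1_plus lam x - m1_minus lam x = jost_beta u m1_plus lam * me_minus lam x) \<and>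
    (\<exists>D. has_Linf_derivative (- (s - s1)) (\<lambda>\<tau> x. cnj (plane_wave \<tau> x) * me_minus \<tau> x) D lam \<and>
         (AE x in lebesgue. plane_wave lam x * D x = jost_f u me_minus lam * m1_minus lam x))"
    using me(1) unfolding Let_def by (intro conjI exI[of _ "\<lambda>x. cnj (plane_wave lam x) * (jost_f u me_minus lam * m1_minus lam x)"])
qed

end
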